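(* Assume that $\mathscr{M}$ (a metric space of nonsingular maps on $X$), $\mathscr{H}$ (a collection of holes) and the seminorm $|\cdot|_s$ satisfy the Lasota--Yorke assumption and the seminorm-strength assumption (both defined in the context). Let $\zeta_1\in(0,1)$, $\zeta_2\in(1,\infty)$, and suppose that $\hat g\in\mathscr{M}\cap\mathscr{E}(\zeta_1,\zeta_2)$ is stably mixing (defined in the context). Then there exist a number $a>0$ and a mixing partition $\mathscr{Q}_{n_0}$ associated with $\hat g$, defining the convex cone $$\mathcal{C}_a=\{\varphi\in L^1(\lambda):\ \varphi\ge 0,\ \varphi\not\equiv 0,\ |\varphi|_s\le a\,\mathbb{E}[\varphi\,|\,\mathscr{Q}_{n_0}]\}\subset L^1(\lambda),$$ as well as constants $\delta_0>0$, $\varepsilon_0>0$, $\Lambda\in(0,1)$ and $C_0>0$, such that the following holds. Let $(\hat f_i)_{i=1}^\infty$ be any sequence of maps in the ball $B(\hat g,\delta_0)\subset\mathscr{M}$, and let $(H_j)_{j=1}^\infty$ be any sequence of holes in $\mathscr{H}$ with $\lambda(H_j)\le\varepsilon_0$ for every $j\in\mathbb{N}$. Then the resulting nonstationary open dynamical system $((F_m),(H_j))$ satisfies: for all $\varphi,\psi\in\mathcal{D}\cap\mathcal{C}_a$, $$\big\|\mathcal{R}_{F_m}(\varphi)-\mathcal{R}_{F_m}(\psi)\big\|_{L^1(\lambda)}\le C_0\Lambda^m\qquad\text{for all } m\in\mathbb{N}$$ (in particular, the normalized transfer operators $\mathcal{R}_{F_m}$ are defined at $\varphi$ and $\psi$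).
   Context: $X$ is a compact Riemannian manifold and $\lambda$ is Riemannian volume on $X$, with $\lambda(X)=1$. $\mathscr{M}$ is a metric space whose elements are nonsingular maps $X\to X$, and $B(\hat g,\delta)$ denotes the ball in $\mathscr{M}$. $\mathscr{H}$ is a collection of Borel subsets of $X$ (holes). **Nonstationary open systems.** Given maps $(\hat f_i)$ from $X$ to $X$ and holes $(H_j)$, set $\widehat F_m=\hat f_m\circ\cdots\circ\hat f_1$, let $S_m=X\setminus\bigcup_{i=1}^m\widehat F_i^{-1}(H_i)$ be the survivor set, and let $F_m=\widehat F_m|_{S_m}$. The pair $((F_m),(H_j))$ is the nonstationary open dynamical system. The transfer operator $\mathcal{L}_{F_m}:L^1(\lambda)\to L^1(\lambda)$ is defined by $\int_X\mathcal{L}_{F_m}(\varphi)\,\psi\,d\lambda=\int_{S_m}\varphi\cdot(\psi\circ F_m)\,d\lambda$ for $\varphi\in L^1(\lambda)$, $\psi\in L^\infty(\lambda)$. The normalized operator is $\mathcal{R}_{F_m}(\varphi)=\mathcal{L}_{F_m}(\varphi)/\|\mathcal{L}_{F_m}(\varphi)\|_{L^1(\lambda)}$, provided the denominator is nonzero. **Lasota--Yorke assumption.** There is a seminorm $|\cdot|_s$ on $L^1(\lambda)$ (possibly taking the value $+\infty$) such that for every $\hat g\in\mathscr{M}$ there exist a neighborhood $\mathscr{N}(\hat g)$ of $\hat g$ in $\mathscr{M}$, $T_1\in\mathbb{N}$, $\theta_{LY}\in(0,1)$ and $C_{LY}>0$ such that for every sequence $(\hat f_i)_{i=1}^\infty$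 in $\mathscr{N}(\hat g)$ and every sequence $(H_j)$ in $\mathscr{H}$, the corresponding nonstationary open system satisfies $|\mathcal{L}_{F_{kT_1}}(\varphi)|_s\le\theta_{LY}^{kT_1}|\varphi|_s+C_{LY}\|\varphi\|_{L^1(\lambda)}$ for all $\varphi\in L^1(\lambda)$ and all $k\in\mathbb{N}$. **Seminorm-strength assumption.** There exist $M_1,M_2>0$ such that (i) for every finite partition $\mathscr{Q}$ of $X$ into measurable sets and every $\varphi\in L^1(\lambda)$ with $|\varphi|_s<\infty$, $|\varphi|_s\ge M_1\sum_{X'\in\mathscr{Q}}|\varphi|X'|_s$; and (ii) for every measurable $X'\subset X$ of positive measure and every $\varphi\in L^1(\lambda)$ with $|\varphi|_s<\infty$, $|\varphi|X'|_s\ge M_2\left|\frac1{\lambda(X')}\int_{X'}\varphi\,d\lambda-\varphi(z)\right|$ for $\lambda$-a.e. $z\in X'$. Here $\varphi|X'$ is the restriction of $\varphi$ to $X'$ and $|\varphi|X'|_s$ is the (localized) seminorm of that restriction on $X'$, e.g. variation over $X'$ when $|\cdot|_s$ is total variation. **Mixing class.** For $\zeta_1\in(0,1)$, $\zeta_2\in(1,\infty)$, a measurable map $\hat g:X\to X$ belongs to $\mathscr{E}(\zeta_1,\zeta_2)$ if there is a sequence $(\mathscr{Q}_n)_{n=1}^\infty$ of finite partitions of $X$ into measurable sets with $\mathrm{diam}_\lambda(\mathscr{Q}_n):=\sup_{A\in\mathscr{Q}_n}\lambda(A)\to0$ as $n\to\infty$, and for every $n$ there is a time $E(\mathscr{Q}_n,\zeta_1,\zeta_2)$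 such that $\zeta_1<\frac{\lambda(J_1\cap\hat g^{-i}(J_2))}{\lambda(J_1)\lambda(J_2)}<\zeta_2$ for all $J_1,J_2\in\mathscr{Q}_n$ and all $i\ge E(\mathscr{Q}_n,\zeta_1,\zeta_2)$. The $\mathscr{Q}_n$ are called the mixing partitions associated with $\hat g$. **Stably mixing.** $\hat g\in\mathscr{M}\cap\mathscr{E}(\zeta_1,\zeta_2)$ is stably mixing if for every mixing partition $\mathscr{Q}_n$ associated with $\hat g$ and every $S\ge E(\mathscr{Q}_n,\zeta_1,\zeta_2)$ there exist $\delta>0$, $\varepsilon>0$ such that for every sequence $(\hat f_k)_{k=1}^S$ in $B(\hat g,\delta)$ and every sequence $(H_j)_{j=1}^S$ in $\mathscr{H}$ with $\lambda(H_j)\le\varepsilon$ for all $1\le j\le S$, $\zeta_1<\frac{\lambda(J_1\cap F_S^{-1}(J_2))}{\lambda(J_1)\lambda(J_2)}<\zeta_2$ for all $J_1,J_2\in\mathscr{Q}_n$. **Densities.** $\mathcal{D}=\{\varphi\in L^1(\lambda):|\varphi|_s<\infty,\ \varphi\ge0,\ \|\varphi\|_{L^1(\lambda)}=1\}$. $\mathbb{E}[\varphi|\mathscr{Q}]$ is conditional expectation with respect to $\lambda$ and the $\sigma$-algebra generated by $\mathscr{Q}$ (on each $Q\in\mathscr{Q}$ it equals $\lambda(Q)^{-1}\int_Q\varphi\,d\lambda$); inequalities of the form $|\varphi|_s\le a\,\mathbb{E}[\varphi|\mathscr{Q}]$ are required at every point. *)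

theory Defs
  imports "HOL-Probability.Probability"
begin

section \<open>Riemannian manifolds and Riemannian volume\<close>

text \<open>The frechet derivative is taken in the ambient vector space, so the following is meant for
  open sets; on a finite-dimensional space \<^term>\<open>Ck_on k S f\<close> is then the usual class of
  \<open>k\<close> times continuously differentiable maps.\<close>

fun Ck_on :: "nat \<Rightarrow> 'v::real_normed_vector set \<Rightarrow> ('v \<Rightarrow> 'w::real_normed_vector) \<Rightarrow> bool" where
  "Ck_on 0 S f \<longleftrightarrow> continuous_on S f"
| "Ck_on (Suc k) S f \<longleftrightarrow> (\<forall>x\<in>S. f differentiable (at x)) \<and>
     (\<forall>v. Ck_on k S (\<lambda>x. frechet_derivative f (at x) v))"

definition smooth_on :: "'v::real_normed_vector set \<Rightarrow> ('v \<Rightarrow> 'w::real_normed_vector) \<Rightarrow> bool" where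
  "smooth_on S f \<longleftrightarrow> (\<forall>k. Ck_on k S f)"

text \<open>A chart is a pair of a domain and a coordinate map, whose values outside the domain are
  irrelevant. The whole type is the manifold; \<open>CARD('n)\<close> is its dimension.\<close>

type_synonym ('a, 'n) chart = "'a set \<times> ('a \<Rightarrow> real^'n)"

definition transition :: "('a, 'n) chart \<Rightarrow> ('a, 'n) chart \<Rightarrow> real^'n \<Rightarrow> real^'n" where
  "transition c c' = snd c' \<circ> inv_into (fst c) (snd c)"

definition smooth_atlas :: "('a::topological_space, 'n::finite) chart set \<Rightarrow> bool" where
  "smooth_atlas \<A> \<longleftrightarrow>
     (\<Union>c\<in>\<A>. fst c) = UNIV \<and>
     (\<forall>(U, \<kappa>)\<in>\<A>. open U \<and> open (\<kappa> ` U) \<and> homeomorphism U (\<kappa> ` U) \<kappa> (inv_into U \<kappa>)) \<and>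
     (\<forall>c\<in>\<A>. \<forall>c'\<in>\<A>. smooth_on (snd c ` (fst c \<inter> fst c')) (transition c c'))"

text \<open>\<open>G c x\<close> is the Gram matrix, at the coordinate point \<open>x\<close>, of the coordinate vector fields
  of the chart \<open>c\<close>.\<close>

definition riemannian_metric ::
  "('a, 'n::finite) chart set \<Rightarrow> (('a, 'n) chart \<Rightarrow> real^'n \<Rightarrow> real^'n^'n) \<Rightarrow> bool" where
  "riemannian_metric \<A> G \<longleftrightarrow>
     (\<forall>c\<in>\<A>. smooth_on (snd c ` fst c) (G c) \<and>
        (\<forall>x\<in>snd c ` fst c. transpose (G c x) = G c x \<and> (\<forall>v. v \<noteq> 0 \<longrightarrow> v \<bullet> (G c x *v v) > 0))) \<and>
     (\<forall>c\<in>\<A>. \<forall>c'\<in>\<A>. \<forall>x\<in>snd c ` (fst c \<inter> fst c'). \<forall>v w.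
        v \<bullet> (G c x *v w) =
        frechet_derivative (transition c c') (at x) v \<bullet>
          (G c' (transition c c' x) *v frechet_derivative (transition c c') (at x) w))"

text \<open>These conditions determine the measure, since countably many chart domains cover the manifold.\<close>

definition riemannian_volume ::
  "('a::topological_space, 'n::finite) chart set \<Rightarrow> (('a, 'n) chart \<Rightarrow> real^'n \<Rightarrow> real^'n^'n)
     \<Rightarrow> 'a measure \<Rightarrow> bool" where
  "riemannian_volume \<A> G vol \<longleftrightarrow>
     sets vol = sets borel \<and>
     (\<forall>c\<in>\<A>. \<forall>B\<in>sets borel. B \<subseteq> fst c \<longrightarrow>
        emeasure vol B = (\<integral>\<^sup>+ x \<in> snd c ` B. ennreal (sqrt (det (G c x))) \<partial>lborel))"

definition compact_riemannian_manifold ::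
  "('a::{t2_space, second_countable_topology}, 'n::finite) chart set
     \<Rightarrow> (('a, 'n) chart \<Rightarrow> real^'n \<Rightarrow> real^'n^'n) \<Rightarrow> bool" where
  "compact_riemannian_manifold \<A> G \<longleftrightarrow>
     compact (UNIV :: 'a set) \<and> smooth_atlas \<A> \<and> riemannian_metric \<A> G"


section \<open>Nonstationary open systems and their transfer operators\<close>

definition nonsingular :: "'a measure \<Rightarrow> ('a \<Rightarrow> 'a) \<Rightarrow> bool" where
  "nonsingular vol f \<longleftrightarrow>
     f \<in> measurable vol vol \<and> (\<forall>A\<in>null_sets vol. f -` A \<inter> space vol \<in> null_sets vol)"

text \<open>Sequences of maps and of holes are indexed from 1 on; their value at 0 is never used.\<close>

fun closed_comp :: "(nat \<Rightarrow> 'a \<Rightarrow> 'a) \<Rightarrow> nat \<Rightarrow> 'a \<Rightarrow> 'a" where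
  "closed_comp f 0 = id"
| "closed_comp f (Suc m) = f (Suc m) \<circ> closed_comp f m"

definition survivor :: "(nat \<Rightarrow> 'a \<Rightarrow> 'a) \<Rightarrow> (nat \<Rightarrow> 'a set) \<Rightarrow> nat \<Rightarrow> 'a set" where
  "survivor f H m = UNIV - (\<Union>i\<in>{1..m}. closed_comp f i -` H i)"

text \<open>Preimage under the partial map \<open>F\<^sub>m\<close>, whose domain is the survivor set.\<close>

definition open_preimage :: "(nat \<Rightarrow> 'a \<Rightarrow> 'a) \<Rightarrow> (nat \<Rightarrow> 'a set) \<Rightarrow> nat \<Rightarrow> 'a set \<Rightarrow> 'a set" where
  "open_preimage f H m A = {x \<in> survivor f H m. closed_comp f m x \<in> A}"

text \<open>Elements of \<open>L\<^sup>1\<close> and \<open>L\<^sup>\<infinity>\<close> are represented by functions; all notions below that depend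
  on an element of \<open>L\<^sup>1\<close> are invariant under changes on null sets.\<close>

definition L1norm :: "'a measure \<Rightarrow> ('a \<Rightarrow> real) \<Rightarrow> real" where
  "L1norm vol \<phi> = (LINT x|vol. \<bar>\<phi> x\<bar>)"

definition Linf :: "'a measure \<Rightarrow> ('a \<Rightarrow> real) set" where
  "Linf vol = {\<psi> \<in> borel_measurable vol. \<exists>B. AE x in vol. \<bar>\<psi> x\<bar> \<le> B}"

text \<open>The choice picks a representative of the unique \<open>L\<^sup>1\<close> class with the duality property.\<close>

definition transfer_op ::
  "'a measure \<Rightarrow> (nat \<Rightarrow> 'a \<Rightarrow> 'a) \<Rightarrow> (nat \<Rightarrow> 'a set) \<Rightarrow> nat \<Rightarrow> ('a \<Rightarrow> real) \<Rightarrow> ('a \<Rightarrow> real)" where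
  "transfer_op vol f H m \<phi> =
     (SOME h. integrable vol h \<and>
        (\<forall>\<psi>\<in>Linf vol. (LINT x|vol. h x * \<psi> x) =
           (LINT x:survivor f H m|vol. \<phi> x * \<psi> (closed_comp f m x))))"

definition normalized_op ::
  "'a measure \<Rightarrow> (nat \<Rightarrow> 'a \<Rightarrow> 'a) \<Rightarrow> (nat \<Rightarrow> 'a set) \<Rightarrow> nat \<Rightarrow> ('a \<Rightarrow> real) \<Rightarrow> ('a \<Rightarrow> real)" where
  "normalized_op vol f H m \<phi> =
     (\<lambda>x. transfer_op vol f H m \<phi> x / L1norm vol (transfer_op vol f H m \<phi>))"


section \<open>Assumptions on the seminorm\<close>

text \<open>\<open>s A \<phi>\<close> is the seminorm on \<open>A\<close> of the restriction of \<open>\<phi>\<close> to \<open>A\<close>; the global seminorm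
  is \<open>s UNIV\<close>. Note that \<open>0 * \<infinity> = 0\<close>, so the seminorm of the zero function is 0.\<close>

definition localized_seminorm :: "'a measure \<Rightarrow> ('a set \<Rightarrow> ('a \<Rightarrow> real) \<Rightarrow> ennreal) \<Rightarrow> bool" where
  "localized_seminorm vol s \<longleftrightarrow>
     (\<forall>A\<in>sets vol.
        (\<forall>\<phi> \<psi>. integrable vol \<phi> \<longrightarrow> integrable vol \<psi> \<longrightarrow>
           (AE x in vol. x \<in> A \<longrightarrow> \<phi> x = \<psi> x) \<longrightarrow> s A \<phi> = s A \<psi>) \<and>
        (\<forall>\<phi> \<psi>. integrable vol \<phi> \<longrightarrow> integrable vol \<psi> \<longrightarrow>
           s A (\<lambda>x. \<phi> x + \<psi> x) \<le> s A \<phi> + s A \<psi>) \<and>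
        (\<forall>c \<phi>. integrable vol \<phi> \<longrightarrow> s A (\<lambda>x. c * \<phi> x) = ennreal \<bar>c\<bar> * s A \<phi>))"

definition lasota_yorke ::
  "'a measure \<Rightarrow> ('a \<Rightarrow> 'a) set \<Rightarrow> (('a \<Rightarrow> 'a) \<Rightarrow> ('a \<Rightarrow> 'a) \<Rightarrow> real) \<Rightarrow> 'a set set
     \<Rightarrow> ('a set \<Rightarrow> ('a \<Rightarrow> real) \<Rightarrow> ennreal) \<Rightarrow> bool" where
  "lasota_yorke vol \<M> d \<H> s \<longleftrightarrow>
     (\<forall>g\<in>\<M>. \<exists>N T\<^sub>1 \<theta> C.
        openin (Metric_space.mtopology \<M> d) N \<and> g \<in> N \<and> T\<^sub>1 \<ge> (1::nat) \<and> 0 < \<theta> \<and> \<theta> < 1 \<and> 0 < C \<and>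
        (\<forall>f H. (\<forall>i\<ge>1. f i \<in> N) \<longrightarrow> (\<forall>j\<ge>1. H j \<in> \<H>) \<longrightarrow>
           (\<forall>\<phi> k. integrable vol \<phi> \<longrightarrow>
              s UNIV (transfer_op vol f H (k * T\<^sub>1) \<phi>)
                \<le> ennreal (\<theta> ^ (k * T\<^sub>1)) * s UNIV \<phi> + ennreal (C * L1norm vol \<phi>))))"

definition seminorm_strength :: "'a measure \<Rightarrow> ('a set \<Rightarrow> ('a \<Rightarrow> real) \<Rightarrow> ennreal) \<Rightarrow> bool" where
  "seminorm_strength vol s \<longleftrightarrow>
     (\<exists>M\<^sub>1 M\<^sub>2. 0 < M\<^sub>1 \<and> 0 < M\<^sub>2 \<and>
        (\<forall>\<Q> \<phi>. finite \<Q> \<longrightarrow> partition_on UNIV \<Q> \<longrightarrow> \<Q> \<subseteq> sets vol \<longrightarrow> integrable vol \<phi> \<longrightarrow>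
           s UNIV \<phi> < \<infinity> \<longrightarrow> ennreal M\<^sub>1 * (\<Sum>A\<in>\<Q>. s A \<phi>) \<le> s UNIV \<phi>) \<and>
        (\<forall>A \<phi>. A \<in> sets vol \<longrightarrow> measure vol A > 0 \<longrightarrow> integrable vol \<phi> \<longrightarrow> s UNIV \<phi> < \<infinity> \<longrightarrow>
           (AE z in vol. z \<in> A \<longrightarrow>
              ennreal (M\<^sub>2 * \<bar>1 / measure vol A * (LINT x:A|vol. \<phi> x) - \<phi> z\<bar>) \<le> s A \<phi>)))"


section \<open>Mixing\<close>

definition mixing_partitions ::
  "'a measure \<Rightarrow> real \<Rightarrow> real \<Rightarrow> ('a \<Rightarrow> 'a) \<Rightarrow> (nat \<Rightarrow> 'a set set) \<Rightarrow> (nat \<Rightarrow> nat) \<Rightarrow> bool" where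
  "mixing_partitions vol \<zeta>\<^sub>1 \<zeta>\<^sub>2 g \<Q> E \<longleftrightarrow>
     (\<forall>n\<ge>1. finite (\<Q> n) \<and> partition_on UNIV (\<Q> n) \<and> \<Q> n \<subseteq> sets vol) \<and>
     (\<lambda>n. SUP A\<in>\<Q> n. measure vol A) \<longlonglongrightarrow> 0 \<and>
     (\<forall>n\<ge>1. \<forall>J\<^sub>1\<in>\<Q> n. \<forall>J\<^sub>2\<in>\<Q> n. \<forall>i\<ge>E n.
        \<zeta>\<^sub>1 < measure vol (J\<^sub>1 \<inter> (g ^^ i) -` J\<^sub>2) / (measure vol J\<^sub>1 * measure vol J\<^sub>2) \<and>
        measure vol (J\<^sub>1 \<inter> (g ^^ i) -` J\<^sub>2) / (measure vol J\<^sub>1 * measure vol J\<^sub>2) < \<zeta>\<^sub>2)"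

definition mixing_class :: "'a measure \<Rightarrow> real \<Rightarrow> real \<Rightarrow> ('a \<Rightarrow> 'a) set" where
  "mixing_class vol \<zeta>\<^sub>1 \<zeta>\<^sub>2 =
     {g \<in> measurable vol vol. \<exists>\<Q> E. mixing_partitions vol \<zeta>\<^sub>1 \<zeta>\<^sub>2 g \<Q> E}"

text \<open>Stable mixing refers to the mixing partitions \<open>\<Q> n\<close> and mixing times \<open>E n\<close> that are
  associated with \<open>g\<close>.\<close>

definition stably_mixing ::
  "'a measure \<Rightarrow> ('a \<Rightarrow> 'a) set \<Rightarrow> (('a \<Rightarrow> 'a) \<Rightarrow> ('a \<Rightarrow> 'a) \<Rightarrow> real) \<Rightarrow> 'a set set \<Rightarrow> real \<Rightarrow> real
     \<Rightarrow> ('a \<Rightarrow> 'a) \<Rightarrow> (nat \<Rightarrow> 'a set set) \<Rightarrow> (nat \<Rightarrow> nat) \<Rightarrow> bool" where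
  "stably_mixing vol \<M> d \<H> \<zeta>\<^sub>1 \<zeta>\<^sub>2 g \<Q> E \<longleftrightarrow>
     (\<forall>n\<ge>1. \<forall>S\<ge>E n. \<exists>\<delta>>0. \<exists>\<epsilon>>0. \<forall>f H.
        (\<forall>k\<in>{1..S}. f k \<in> Metric_space.mball \<M> d g \<delta>) \<longrightarrow>
        (\<forall>j\<in>{1..S}. H j \<in> \<H> \<and> measure vol (H j) \<le> \<epsilon>) \<longrightarrow>
        (\<forall>J\<^sub>1\<in>\<Q> n. \<forall>J\<^sub>2\<in>\<Q> n.
           \<zeta>\<^sub>1 < measure vol (J\<^sub>1 \<inter> open_preimage f H S J\<^sub>2) / (measure vol J\<^sub>1 * measure vol J\<^sub>2) \<and>
           measure vol (J\<^sub>1 \<inter> open_preimage f H S J\<^sub>2) / (measure vol J\<^sub>1 * measure vol J\<^sub>2) < \<zeta>\<^sub>2))"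


section \<open>Densities and cones\<close>

definition densities :: "'a measure \<Rightarrow> ('a set \<Rightarrow> ('a \<Rightarrow> real) \<Rightarrow> ennreal) \<Rightarrow> ('a \<Rightarrow> real) set" where
  "densities vol s =
     {\<phi>. integrable vol \<phi> \<and> s UNIV \<phi> < \<infinity> \<and> (AE x in vol. 0 \<le> \<phi> x) \<and> L1norm vol \<phi> = 1}"

text \<open>The conditional expectation is measurable with respect to the algebra generated by \<open>\<Q>\<close>, hence
  constant on the members of \<open>\<Q>\<close>. If these have positive measure, the pointwise inequality therefore
  does not depend on the version chosen by \<^const>\<open>real_cond_exp\<close>.\<close>

definition density_cone ::
  "'a measure \<Rightarrow> ('a set \<Rightarrow> ('a \<Rightarrow> real) \<Rightarrow> ennreal) \<Rightarrow> real \<Rightarrow> 'a set set \<Rightarrow> ('a \<Rightarrow> real) set" where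
  "density_cone vol s a \<Q> =
     {\<phi>. integrable vol \<phi> \<and> (AE x in vol. 0 \<le> \<phi> x) \<and> \<not> (AE x in vol. \<phi> x = 0) \<and>
        (\<forall>x. s UNIV \<phi> \<le> ennreal (a * real_cond_exp vol (sigma UNIV \<Q>) \<phi> x))}"

lemma real_cond_exp_partition:
  assumes "prob_space vol" "space vol = UNIV" "finite \<Q>" "partition_on UNIV \<Q>" "\<Q> \<subseteq> sets vol"
    and int: "integrable vol \<phi>" and "Q \<in> \<Q>" "measure vol Q > 0" "x \<in> Q"
  shows "real_cond_exp vol (sigma UNIV \<Q>) \<phi> x = 1 / measure vol Q * (LINT y:Q|vol. \<phi> y)"
proof -
  interpret prob_space vol by fact
  let ?F = "sigma UNIV \<Q>" and ?h = "real_cond_exp vol (sigma UNIV \<Q>) \<phi>"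
  have sub: "subalgebra vol ?F"
    using assms(2,5) unfolding subalgebra_def
    by (simp add: space_measure_of_conv sets_measure_of_conv)
       (metis sets.sigma_sets_subset)
  interpret finite_measure_subalgebra vol ?F
    by unfold_locales (fact sub)
  have Q: "Q \<in> sets ?F" "Q \<in> sets vol" using assms by (auto simp: sets_measure_of_conv)
  have atom: "Q \<subseteq> A \<or> Q \<inter> A = {}" if "A \<in> sets ?F" for A
  proof -
    from that have "A \<in> sigma_sets UNIV \<Q>" by (simp add: sets_measure_of_conv)
    then show ?thesis
    proof induction
      case (Basic A)
      then show ?case using assms(4,7) unfolding partition_on_def disjoint_def by blast
    qed auto
  qed
  have const: "?h y = ?h x" if "y \<in> Q" for y
  proof -
    have "?h -` {?h x} \<inter> space ?F \<in> sets ?F"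
      by (rule measurable_sets[OF borel_measurable_cond_exp]) simp
    from atom[OF this] show ?thesis using that assms(9) by (auto simp: space_measure_of_conv)
  qed
  have "(LINT y:Q|vol. \<phi> y) = (LINT y:Q|vol. ?h y)"
    by (rule real_cond_exp_intA[OF int Q(1)])
  also have "\<dots> = (LINT y:Q|vol. ?h x)"
    by (rule set_lebesgue_integral_cong) (use const Q in auto)
  also have "\<dots> = measure vol Q * ?h x"
    using Q unfolding set_lebesgue_integral_def by simp
  finally show ?thesis using assms(8) by simp
qed

end

theory Submission
  imports Defs
begin

text \<open>Averages over the atoms of the mixing partition dominate the seminorm on the cone, and the
  seminorm controls the oscillation on each atom. Mixing over one block of length \<open>T\<close> therefore
  spreads mass evenly: all averages of the block image are comparable to the total mass, while by the
  Lasota--Yorke inequality its seminorm is small against them. Hence \<open>L \<phi> - c L \<psi>\<close> lies in the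
  cone whenever \<open>\<phi>\<close> carries at least the mass of \<open>\<psi>\<close>, provided that the cone does not prescribe
  a sign; nonnegativity of \<open>L \<phi> - c L \<psi>\<close> itself would not follow. If
  \<open>\<alpha> v \<le> u \<le> \<beta> v\<close> in the order of this cone, then \<open>u - \<alpha> v\<close> or \<open>\<beta> v - u\<close> carries half of the
  mass of \<open>(\<beta> - \<alpha>) v\<close>, so that the next block shrinks \<open>\<beta> - \<alpha>\<close> by a fixed factor. This replaces
  the Hilbert metric.\<close>

section \<open>Transfer operators\<close>

text \<open>The constants must be chosen without a circle, since cone, block length and size of the
  perturbation depend on one another. The additive Lasota--Yorke constant does not see the
  partition, so it fixes \<open>a\<close>; \<open>a\<close> fixes how small the atoms must be; the
  partition fixes its mixing time and with it the block length \<open>T\<close>, which must also be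
  long enough for the contraction factor; stable mixing at time \<open>T\<close> then supplies
  radius and hole size. All estimates are uniform over a class of systems closed under time shifts,
  because each later block of a nonstationary system is the first block of a different system. Mass
  leaks through the holes, so no lower bound on it that is uniform in time is available. Every
  estimate is therefore homogeneous: the error and the normalizing factor are both measured in the
  mass of the same iterate, which cancels.\<close>

definition transfers_to ::
  "'a measure \<Rightarrow> 'a set \<Rightarrow> ('a \<Rightarrow> 'a) \<Rightarrow> ('a \<Rightarrow> real) \<Rightarrow> ('a \<Rightarrow> real) \<Rightarrow> bool" where
  "transfers_to vol S F \<phi> h \<longleftrightarrow> integrable vol h \<and>
     (\<forall>\<psi>\<in>Linf vol. (LINT x|vol. h x * \<psi> x) = (LINT x:S|vol. \<phi> x * \<psi> (F x)))"

lemma Linf_measurable: "\<psi> \<in> Linf vol \<Longrightarrow> \<psi> \<in> borel_measurable vol"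
  by (simp add: Linf_def)

lemma LinfI:
  assumes "\<psi> \<in> borel_measurable vol" "\<And>x. \<bar>\<psi> x\<bar> \<le> B"
  shows "\<psi> \<in> Linf vol"
  using assms unfolding Linf_def by auto

lemma Linf_indicator: "A \<in> sets vol \<Longrightarrow> indicator A \<in> Linf vol"
  by (rule LinfI[where B = 1]) (auto simp: indicator_def)

lemma Linf_sgn: "h \<in> borel_measurable vol \<Longrightarrow> (\<lambda>x. sgn (h x)) \<in> Linf vol"
  by (rule LinfI[where B = 1]) (auto simp: sgn_real_def)

lemma Linf_mult_indicator:
  assumes "\<psi> \<in> Linf vol" "A \<in> sets vol"
  shows "(\<lambda>x. indicator A x * \<psi> x) \<in> Linf vol"
proof -
  obtain B where B: "AE x in vol. \<bar>\<psi> x\<bar> \<le> B" and [measurable]: "\<psi> \<in> borel_measurable vol"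
    using assms by (auto simp: Linf_def)
  have "AE x in vol. \<bar>indicator A x * \<psi> x\<bar> \<le> B"
    using B by eventually_elim (auto simp: indicator_def)
  then show ?thesis using assms(2) unfolding Linf_def by auto
qed

text \<open>The exceptional null set pulls back to a null set. This is what makes composition with
  \<open>F\<close> respect a.e. classes, and hence act on \<open>Linf\<close>.\<close>

lemma nonsingular_AE:
  assumes "nonsingular vol F" "AE x in vol. P x"
  shows "AE x in vol. P (F x)"
proof -
  obtain N where N: "{x \<in> space vol. \<not> P x} \<subseteq> N" "N \<in> null_sets vol"
    using assms(2) by (auto simp: eventually_ae_filter)
  have "F -` N \<inter> space vol \<in> null_sets vol"
    using assms(1) N(2) by (auto simp: nonsingular_def)
  moreover have "{x \<in> space vol. \<not> P (F x)} \<subseteq> F -` N \<inter> space vol"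
    using N(1) assms(1) measurable_space[of F vol vol] by (auto simp: nonsingular_def)
  ultimately show ?thesis unfolding eventually_ae_filter by blast
qed

lemma Linf_comp:
  assumes "nonsingular vol F" "\<psi> \<in> Linf vol"
  shows "(\<lambda>x. \<psi> (F x)) \<in> Linf vol"
proof -
  obtain B where B: "AE x in vol. \<bar>\<psi> x\<bar> \<le> B" and [measurable]: "\<psi> \<in> borel_measurable vol"
    using assms by (auto simp: Linf_def)
  have [measurable]: "F \<in> measurable vol vol"
    using assms by (simp add: nonsingular_def)
  show ?thesis unfolding Linf_def
    using nonsingular_AE[OF assms(1) B] by auto
qed

lemma Linf_integrable_mult:
  fixes \<phi> :: "'a \<Rightarrow> real"
  assumes "integrable vol \<phi>" "\<psi> \<in> Linf vol"
  shows "integrable vol (\<lambda>x. \<phi> x * \<psi> x)"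
proof -
  obtain B where B: "AE x in vol. \<bar>\<psi> x\<bar> \<le> B" and [measurable]: "\<psi> \<in> borel_measurable vol"
    using assms by (auto simp: Linf_def)
  have [measurable]: "\<phi> \<in> borel_measurable vol" using assms(1) by simp
  show ?thesis
  proof (rule Bochner_Integration.integrable_bound)
    show "integrable vol (\<lambda>x. B * \<phi> x)" using assms(1) by simp
    show "AE x in vol. norm (\<phi> x * \<psi> x) \<le> norm (B * \<phi> x)"
      using B
    proof eventually_elim
      case (elim x)
      have "\<bar>\<phi> x\<bar> * \<bar>\<psi> x\<bar> \<le> \<bar>\<phi> x\<bar> * \<bar>B\<bar>" using elim by (intro mult_left_mono) auto
      then show ?case by (simp add: abs_mult mult.commute)
    qed
  qed measurable
qed

lemma set_integrable_transfer:
  fixes \<phi> :: "'a \<Rightarrow> real"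
  assumes "nonsingular vol F" "S \<in> sets vol" "integrable vol \<phi>" "\<psi> \<in> Linf vol"
  shows "set_integrable vol S (\<lambda>x. \<phi> x * \<psi> (F x))"
proof -
  have "integrable vol (\<lambda>x. \<phi> x * (indicator S x * \<psi> (F x)))"
    by (rule Linf_integrable_mult[OF assms(3) Linf_mult_indicator[OF Linf_comp[OF assms(1,4)] assms(2)]])
  then show ?thesis unfolding set_integrable_def by (simp add: mult_ac)
qed

lemma nonsingular_comp:
  assumes "nonsingular vol f" "nonsingular vol g"
  shows "nonsingular vol (f \<circ> g)"
proof -
  have m: "f \<in> measurable vol vol" "g \<in> measurable vol vol"
    using assms by (auto simp: nonsingular_def)
  have "(f \<circ> g) -` A \<inter> space vol \<in> null_sets vol" if "A \<in> null_sets vol" for A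
  proof -
    have "(f \<circ> g) -` A \<inter> space vol = g -` (f -` A \<inter> space vol) \<inter> space vol"
      using measurable_space[OF m(2)] by auto
    moreover have "f -` A \<inter> space vol \<in> null_sets vol"
      using assms(1) that by (simp add: nonsingular_def)
    then have "g -` (f -` A \<inter> space vol) \<inter> space vol \<in> null_sets vol"
      using assms(2) unfolding nonsingular_def by blast
    ultimately show ?thesis by metis
  qed
  then show ?thesis using m by (auto simp: nonsingular_def intro: measurable_comp)
qed

lemma nonsingular_id: "nonsingular vol id"
proof -
  have "id -` A \<inter> space vol = A" if "A \<in> null_sets vol" for A
    using that sets.sets_into_space[of A vol] by auto
  then show ?thesis unfolding nonsingular_def by auto
qed

text \<open>The function sought is the Radon--Nikodym density of the push-forward under
  \<open>F\<close> of the measure with density \<open>indicator S x * \<phi> x\<close>.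
  Nonsingularity makes the push-forward absolutely continuous, and its total mass is the integral of
  \<open>\<phi>\<close> over \<open>S\<close>, so the density is integrable.\<close>

lemma (in sigma_finite_measure) exists_transfer_nonneg:
  assumes ns: "nonsingular M F" and S: "S \<in> sets M" and int: "integrable M \<phi>"
    and pos: "\<And>x. 0 \<le> \<phi> x"
  shows "\<exists>h. transfers_to M S F \<phi> h"
proof -
  have F[measurable]: "F \<in> measurable M M" using ns by (simp add: nonsingular_def)
  have [measurable]: "\<phi> \<in> borel_measurable M" "S \<in> sets M" using int S by auto
  define w where "w = (\<lambda>x. indicator S x * \<phi> x)"
  have [measurable]: "w \<in> borel_measurable M" unfolding w_def by measurable
  have w0: "0 \<le> w x" for x using pos by (simp add: w_def)
  have wint: "integrable M w"
    unfolding w_def using integrable_mult_indicator[OF S int] by simp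
  define N where "N = distr (density M (\<lambda>x. ennreal (w x))) M F"
  have ac: "absolutely_continuous M N"
    unfolding absolutely_continuous_def
  proof
    fix A assume A: "A \<in> null_sets M"
    then have "F -` A \<inter> space M \<in> null_sets M" using ns by (auto simp: nonsingular_def)
    then have "F -` A \<inter> space M \<in> null_sets (density M (\<lambda>x. ennreal (w x)))"
      using absolutely_continuousI_density[of "\<lambda>x. ennreal (w x)" M]
      by (auto simp: absolutely_continuous_def)
    then show "A \<in> null_sets N"
      using A unfolding N_def by (subst null_sets_distr_iff) auto
  qed
  obtain k where [measurable]: "k \<in> borel_measurable M" and k: "density M k = N"
    using Radon_Nikodym[OF ac] by (auto simp: N_def)
  \<comment> \<open>The density \<open>k\<close> takes values in \<open>ennreal\<close>; its finite
    integral makes it finite almost everywhere, so that it can be replaced by a real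
    function.\<close>
  have "(\<integral>\<^sup>+x. k x \<partial>M) = emeasure N (space M)"
    unfolding k[symmetric] by (simp add: emeasure_density cong: nn_integral_cong)
  also have "\<dots> = (\<integral>\<^sup>+x. ennreal (w x) \<partial>M)"
    unfolding N_def by (simp add: emeasure_distr emeasure_density cong: nn_integral_cong)
       (auto intro!: nn_integral_cong simp: indicator_def dest: measurable_space[OF F])
  also have "\<dots> < \<infinity>"
    using wint w0 by (simp add: integrable_iff_bounded)
  finally have kfin: "(\<integral>\<^sup>+x. k x \<partial>M) \<noteq> \<infinity>" by simp
  have kAE: "AE x in M. k x = ennreal (enn2real (k x))"
    using nn_integral_PInf_AE[OF _ kfin] by (auto simp: less_top)
  define h where "h = (\<lambda>x. enn2real (k x))"
  have [measurable]: "h \<in> borel_measurable M" unfolding h_def by measurable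
  have hN: "density M (\<lambda>x. ennreal (h x)) = N"
    unfolding k[symmetric] h_def by (rule density_cong) (use kAE in auto)
  have "(\<integral>\<^sup>+x. ennreal (h x) \<partial>M) = (\<integral>\<^sup>+x. k x \<partial>M)"
    by (rule nn_integral_cong_AE) (use kAE in \<open>auto simp: h_def\<close>)
  then have hint: "integrable M h"
    using kfin by (auto simp: integrable_iff_bounded h_def less_top)
  have "(LINT x|M. h x * \<psi> x) = (LINT x:S|M. \<phi> x * \<psi> (F x))" if "\<psi> \<in> Linf M" for \<psi>
  proof -
    have [measurable]: "\<psi> \<in> borel_measurable M" using that by (rule Linf_measurable)
    have "(LINT x|M. h x * \<psi> x) = (LINT x|density M (\<lambda>x. ennreal (h x)). \<psi> x)"
      by (subst integral_density) (auto simp: h_def)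
    also have "\<dots> = (LINT x|density M (\<lambda>x. ennreal (w x)). \<psi> (F x))"
      unfolding hN unfolding N_def by (subst integral_distr) auto
    also have "\<dots> = (LINT x|M. w x * \<psi> (F x))"
      by (subst integral_density) (auto simp: w0)
    finally show ?thesis by (simp add: w_def set_lebesgue_integral_def mult_ac)
  qed
  then show ?thesis using hint unfolding transfers_to_def by auto
qed

lemma transfers_to_linear:
  assumes "nonsingular vol F" "S \<in> sets vol" "integrable vol \<phi>" "integrable vol \<psi>"
    and "transfers_to vol S F \<phi> h" "transfers_to vol S F \<psi> k"
  shows "transfers_to vol S F (\<lambda>x. b * \<phi> x + c * \<psi> x) (\<lambda>x. b * h x + c * k x)"
proof -
  have int: "integrable vol h" "integrable vol k"
    using assms by (auto simp: transfers_to_def)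
  have "(LINT x|vol. (b * h x + c * k x) * \<eta> x)
          = (LINT x:S|vol. (b * \<phi> x + c * \<psi> x) * \<eta> (F x))" if \<eta>: "\<eta> \<in> Linf vol" for \<eta>
  proof -
    note i = Linf_integrable_mult[OF int(1) \<eta>] Linf_integrable_mult[OF int(2) \<eta>]
    note j = set_integrable_transfer[OF assms(1,2,3) \<eta>] set_integrable_transfer[OF assms(1,2,4) \<eta>]
    have "(LINT x|vol. (b * h x + c * k x) * \<eta> x)
        = b * (LINT x|vol. h x * \<eta> x) + c * (LINT x|vol. k x * \<eta> x)"
      using i by (simp add: distrib_right mult.assoc)
    also have "\<dots> = b * (LINT x:S|vol. \<phi> x * \<eta> (F x)) + c * (LINT x:S|vol. \<psi> x * \<eta> (F x))"
      using assms(5,6) \<eta> by (simp add: transfers_to_def)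
    also have "\<dots> = (LINT x:S|vol. b * (\<phi> x * \<eta> (F x)) + c * (\<psi> x * \<eta> (F x)))"
      using j by (subst set_integral_add) (auto intro: set_integrable_mult_right)
    finally show ?thesis by (simp add: distrib_right mult.assoc)
  qed
  then show ?thesis using int by (auto simp: transfers_to_def)
qed

lemma (in sigma_finite_measure) exists_transfer:
  assumes ns: "nonsingular M F" and S: "S \<in> sets M" and int: "integrable M \<phi>"
  shows "\<exists>h. transfers_to M S F \<phi> h"
proof -
  have i: "integrable M (\<lambda>x. max 0 (\<phi> x))" "integrable M (\<lambda>x. max 0 (- \<phi> x))"
    using int by auto
  obtain h k where "transfers_to M S F (\<lambda>x. max 0 (\<phi> x)) h"
      "transfers_to M S F (\<lambda>x. max 0 (- \<phi> x)) k"
    using exists_transfer_nonneg[OF ns S i(1)] exists_transfer_nonneg[OF ns S i(2)] by auto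
  from transfers_to_linear[OF ns S i this, of 1 "-1"]
  have "transfers_to M S F (\<lambda>x. 1 * max 0 (\<phi> x) + (- 1) * max 0 (- \<phi> x)) (\<lambda>x. 1 * h x + (-1) * k x)" .
  moreover have "(\<lambda>x. 1 * max 0 (\<phi> x) + (- 1) * max 0 (- \<phi> x)) = \<phi>" by (auto simp: max_def)
  ultimately show ?thesis by auto
qed

text \<open>Testing against the sign of \<open>h - k\<close>, a bounded function, recovers the L1
  distance of \<open>h\<close> and \<open>k\<close>.\<close>

lemma transfers_to_unique:
  assumes "transfers_to vol S F \<phi> h" "transfers_to vol S F \<phi> k"
  shows "AE x in vol. h x = k x"
proof -
  have int: "integrable vol h" "integrable vol k"
    using assms by (auto simp: transfers_to_def)
  define \<psi> where "\<psi> = (\<lambda>x. sgn (h x - k x))"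
  have \<psi>: "\<psi> \<in> Linf vol" unfolding \<psi>_def using int by (intro Linf_sgn) auto
  have "(LINT x|vol. \<bar>h x - k x\<bar>) = (LINT x|vol. h x * \<psi> x - k x * \<psi> x)"
    by (rule Bochner_Integration.integral_cong)
       (auto simp: \<psi>_def abs_sgn algebra_simps)
  also have "\<dots> = (LINT x|vol. h x * \<psi> x) - (LINT x|vol. k x * \<psi> x)"
    by (rule Bochner_Integration.integral_diff) (intro Linf_integrable_mult int \<psi>)+
  also have "\<dots> = 0" using assms \<psi> by (simp add: transfers_to_def)
  finally have "(LINT x|vol. \<bar>h x - k x\<bar>) = 0" .
  then have "AE x in vol. \<bar>h x - k x\<bar> = 0"
    using int by (subst (asm) integral_nonneg_eq_0_iff_AE) auto
  then show ?thesis by auto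
qed

text \<open>Testing against \<open>sgn (h x)\<close> turns the norm of \<open>h\<close> into an
  integral of \<open>\<phi>\<close> against a function bounded by 1.\<close>

lemma transfers_to_L1norm_le:
  assumes "nonsingular vol F" "S \<in> sets vol" "integrable vol \<phi>" "transfers_to vol S F \<phi> h"
  shows "L1norm vol h \<le> L1norm vol \<phi>"
proof -
  have h: "integrable vol h" using assms by (simp add: transfers_to_def)
  then have \<psi>: "(\<lambda>x. sgn (h x)) \<in> Linf vol" by (intro Linf_sgn) auto
  have "L1norm vol h = (LINT x|vol. h x * sgn (h x))"
    unfolding L1norm_def by (simp add: abs_sgn)
  also have "\<dots> = (LINT x:S|vol. \<phi> x * sgn (h (F x)))"
    using assms(4) \<psi> by (simp add: transfers_to_def)
  also have "\<dots> \<le> L1norm vol \<phi>"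
    unfolding L1norm_def set_lebesgue_integral_def
  proof (rule integral_mono)
    show "integrable vol (\<lambda>x. indicator S x *\<^sub>R (\<phi> x * sgn (h (F x))))"
      using set_integrable_transfer[OF assms(1,2,3) \<psi>] by (simp add: set_integrable_def)
    show "integrable vol (\<lambda>x. \<bar>\<phi> x\<bar>)" using assms(3) by simp
    show "indicator S x *\<^sub>R (\<phi> x * sgn (h (F x))) \<le> \<bar>\<phi> x\<bar>" for x
      by (auto simp: indicator_def sgn_real_def)
  qed
  finally show ?thesis .
qed

text \<open>Testing against the indicator of the set where \<open>h\<close> is negative gives a
  number that is nonnegative on the side of \<open>\<phi>\<close> and nonpositive on the side of
  \<open>h\<close>.\<close>

lemma transfers_to_nonneg:
  assumes "transfers_to vol S F \<phi> h" "AE x in vol. 0 \<le> \<phi> x"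
  shows "AE x in vol. 0 \<le> h x"
proof -
  have h: "integrable vol h" using assms by (simp add: transfers_to_def)
  then have [measurable]: "h \<in> borel_measurable vol" by simp
  define \<psi> :: "'a \<Rightarrow> real" where "\<psi> = (\<lambda>x. if h x < 0 then 1 else 0)"
  have [measurable]: "\<psi> \<in> borel_measurable vol" unfolding \<psi>_def by measurable
  have \<psi>: "\<psi> \<in> Linf vol" by (rule LinfI[where B = 1]) (auto simp: \<psi>_def)
  have "0 \<le> (LINT x:S|vol. \<phi> x * \<psi> (F x))"
    unfolding set_lebesgue_integral_def
    by (rule integral_nonneg_AE) (use assms(2) in \<open>auto simp: \<psi>_def\<close>)
  also have "\<dots> = (LINT x|vol. h x * \<psi> x)"
    using assms(1) \<psi> by (simp add: transfers_to_def)
  finally have "(LINT x|vol. - (h x * \<psi> x)) \<le> 0" by simp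
  moreover have "0 \<le> (LINT x|vol. - (h x * \<psi> x))"
    by (rule Bochner_Integration.integral_nonneg) (simp add: \<psi>_def)
  ultimately have "(LINT x|vol. - (h x * \<psi> x)) = 0" by linarith
  then have "AE x in vol. - (h x * \<psi> x) = 0"
    using Linf_integrable_mult[OF h \<psi>]
    by (subst (asm) integral_nonneg_eq_0_iff_AE) (auto simp: \<psi>_def)
  then show ?thesis by eventually_elim (auto simp: \<psi>_def split: if_splits)
qed

lemma transfers_to_set_integral:
  assumes "transfers_to vol S F \<phi> h" "A \<in> sets vol"
  shows "(LINT x:A|vol. h x) = (LINT x:{x\<in>S. F x \<in> A}|vol. \<phi> x)"
proof -
  have "(LINT x:A|vol. h x) = (LINT x|vol. h x * indicator A x)"
    by (simp add: set_lebesgue_integral_def mult.commute)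
  also have "\<dots> = (LINT x:S|vol. \<phi> x * indicator A (F x))"
    using assms Linf_indicator by (auto simp: transfers_to_def)
  also have "\<dots> = (LINT x:{x\<in>S. F x \<in> A}|vol. \<phi> x)"
    unfolding set_lebesgue_integral_def
    by (rule Bochner_Integration.integral_cong) (auto simp: indicator_def)
  finally show ?thesis .
qed

text \<open>The second cut-off is absorbed into the test function: the product of
  \<open>indicator S'\<close> with \<open>\<psi>\<close> composed with \<open>F'\<close> is again
  essentially bounded, hence admissible in the duality relation of the first map.\<close>

lemma transfers_to_comp:
  assumes "nonsingular vol F'" "S' \<in> sets vol"
    and "transfers_to vol S F \<phi> h" "transfers_to vol S' F' h k"
  shows "transfers_to vol {x \<in> S. F x \<in> S'} (F' \<circ> F) \<phi> k"
proof -
  have "(LINT x|vol. k x * \<psi> x) = (LINT x:{x \<in> S. F x \<in> S'}|vol. \<phi> x * \<psi> ((F' \<circ> F) x))"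
    if \<psi>: "\<psi> \<in> Linf vol" for \<psi>
  proof -
    have \<psi>': "(\<lambda>x. indicator S' x * \<psi> (F' x)) \<in> Linf vol"
      by (rule Linf_mult_indicator[OF Linf_comp[OF assms(1) \<psi>] assms(2)])
    have "(LINT x|vol. k x * \<psi> x) = (LINT x:S'|vol. h x * \<psi> (F' x))"
      using assms(4) \<psi> by (simp add: transfers_to_def)
    also have "\<dots> = (LINT x|vol. h x * (indicator S' x * \<psi> (F' x)))"
      unfolding set_lebesgue_integral_def by (simp add: mult_ac)
    also have "\<dots> = (LINT x:S|vol. \<phi> x * (indicator S' (F x) * \<psi> (F' (F x))))"
      using assms(3) \<psi>' by (simp add: transfers_to_def)
    also have "\<dots> = (LINT x:{x \<in> S. F x \<in> S'}|vol. \<phi> x * \<psi> ((F' \<circ> F) x))"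
      unfolding set_lebesgue_integral_def
      by (rule Bochner_Integration.integral_cong) (auto simp: indicator_def)
    finally show ?thesis .
  qed
  then show ?thesis using assms by (auto simp: transfers_to_def)
qed

section \<open>Splitting an open system at an intermediate time\<close>

lemma closed_comp_add:
  "closed_comp f (m + k) = closed_comp (\<lambda>i. f (m + i)) k \<circ> closed_comp f m"
  by (induction k) (auto simp: fun_eq_iff)

text \<open>A hole met at time \<open>m + j\<close> is met at time \<open>j\<close> by the shifted
  system started from the position at time \<open>m\<close>.\<close>

lemma survivor_add:
  "survivor f H (m + k) =
     {x \<in> survivor f H m. closed_comp f m x \<in> survivor (\<lambda>i. f (m + i)) (\<lambda>i. H (m + i)) k}"
proof -
  have "(\<exists>i\<in>{1..m + k}. P i) \<longleftrightarrow> (\<exists>i\<in>{1..m}. P i) \<or> (\<exists>j\<in>{1..k}. P (m + j))" for P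
  proof
    assume "\<exists>i\<in>{1..m + k}. P i"
    then obtain i where i: "i \<in> {1..m + k}" "P i" by blast
    show "(\<exists>i\<in>{1..m}. P i) \<or> (\<exists>j\<in>{1..k}. P (m + j))"
    proof (cases "i \<le> m")
      case True
      then show ?thesis using i by auto
    next
      case False
      then have "i - m \<in> {1..k}" "P (m + (i - m))" using i by auto
      then show ?thesis by blast
    qed
  next
    assume "(\<exists>i\<in>{1..m}. P i) \<or> (\<exists>j\<in>{1..k}. P (m + j))"
    then show "\<exists>i\<in>{1..m + k}. P i"
    proof
      assume "\<exists>j\<in>{1..k}. P (m + j)"
      then obtain j where "j \<in> {1..k}" "P (m + j)" by blast
      then show ?thesis by (intro bexI[of _ "m + j"]) auto
    qed auto
  qed
  note * = this[of "\<lambda>i. closed_comp f i x \<in> H i" for x]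
  show ?thesis
    unfolding survivor_def set_eq_iff using * by (simp add: closed_comp_add)
qed

text \<open>Constraining only indices from 1 on makes the condition invariant under every time shift
  \<open>m\<close>, including \<open>m = 0\<close>.\<close>

definition open_system :: "'a measure \<Rightarrow> (nat \<Rightarrow> 'a \<Rightarrow> 'a) \<Rightarrow> (nat \<Rightarrow> 'a set) \<Rightarrow> bool" where
  "open_system vol f H \<longleftrightarrow> space vol = UNIV \<and>
     (\<forall>i\<ge>1. nonsingular vol (f i)) \<and> (\<forall>i\<ge>1. H i \<in> sets vol)"

lemma open_system_shift:
  "open_system vol f H \<Longrightarrow> open_system vol (\<lambda>i. f (m + i)) (\<lambda>i. H (m + i))"
  by (auto simp: open_system_def)

lemma closed_comp_nonsingular:
  "open_system vol f H \<Longrightarrow> nonsingular vol (closed_comp f m)"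
proof (induction m)
  case (Suc m)
  then have "nonsingular vol (f (Suc m))" by (simp add: open_system_def)
  from nonsingular_comp[OF this Suc.IH[OF Suc.prems]] show ?case by (simp add: o_def)
qed (simp add: nonsingular_id)

lemma survivor_sets:
  assumes "open_system vol f H"
  shows "survivor f H m \<in> sets vol"
proof -
  have "closed_comp f i -` H i \<in> sets vol" if "i \<in> {1..m}" for i
  proof -
    have "closed_comp f i \<in> measurable vol vol"
      using closed_comp_nonsingular[OF assms] by (simp add: nonsingular_def)
    moreover have "H i \<in> sets vol" using assms that by (simp add: open_system_def)
    ultimately have "closed_comp f i -` H i \<inter> space vol \<in> sets vol" by (rule measurable_sets)
    then show ?thesis using assms by (simp add: open_system_def)
  qed
  then have "(\<Union>i\<in>{1..m}. closed_comp f i -` H i) \<in> sets vol" by blast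
  then have "space vol - (\<Union>i\<in>{1..m}. closed_comp f i -` H i) \<in> sets vol" by blast
  then show ?thesis using assms by (simp add: survivor_def open_system_def)
qed

context sigma_finite_measure
begin

lemma transfer_op:
  assumes "open_system M f H" "integrable M \<phi>"
  shows "transfers_to M (survivor f H m) (closed_comp f m) \<phi> (transfer_op M f H m \<phi>)"
  using someI_ex[OF exists_transfer[OF closed_comp_nonsingular[OF assms(1)]
        survivor_sets[OF assms(1)] assms(2)], of m m]
  by (simp add: transfer_op_def transfers_to_def)

lemma transfer_op_integrable:
  "open_system M f H \<Longrightarrow> integrable M \<phi> \<Longrightarrow> integrable M (transfer_op M f H m \<phi>)"
  using transfer_op[of f H \<phi> m] by (simp add: transfers_to_def)

text \<open>Both sides satisfy the duality relation of the composed partial map. Since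
  \<open>transfer_op\<close> chooses its representative arbitrarily, the identity is one of a.e.
  classes, and whatever is proved about blocks has to be transported by a.e. congruence.\<close>

lemma transfer_op_add:
  assumes "open_system M f H" "integrable M \<phi>"
  shows "AE x in M. transfer_op M f H (m + k) \<phi> x =
    transfer_op M (\<lambda>i. f (m + i)) (\<lambda>i. H (m + i)) k (transfer_op M f H m \<phi>) x"
proof (rule transfers_to_unique[OF transfer_op[OF assms]])
  note sh = open_system_shift[OF assms(1), of m]
  show "transfers_to M (survivor f H (m + k)) (closed_comp f (m + k)) \<phi>
     (transfer_op M (\<lambda>i. f (m + i)) (\<lambda>i. H (m + i)) k (transfer_op M f H m \<phi>))"
    unfolding survivor_add closed_comp_add
    by (rule transfers_to_comp[OF closed_comp_nonsingular[OF sh] survivor_sets[OF sh]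
          transfer_op[OF assms] transfer_op[OF sh transfer_op_integrable[OF assms]]])
qed

lemma transfer_op_linear:
  assumes "open_system M f H" "integrable M \<phi>" "integrable M \<psi>"
  shows "AE x in M. transfer_op M f H m (\<lambda>x. b * \<phi> x + c * \<psi> x) x =
    b * transfer_op M f H m \<phi> x + c * transfer_op M f H m \<psi> x"
proof (rule transfers_to_unique)
  show "transfers_to M (survivor f H m) (closed_comp f m) (\<lambda>x. b * \<phi> x + c * \<psi> x)
    (transfer_op M f H m (\<lambda>x. b * \<phi> x + c * \<psi> x))"
    by (rule transfer_op[OF assms(1)]) (use assms in simp)
  show "transfers_to M (survivor f H m) (closed_comp f m) (\<lambda>x. b * \<phi> x + c * \<psi> x)
    (\<lambda>x. b * transfer_op M f H m \<phi> x + c * transfer_op M f H m \<psi> x)"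
    by (rule transfers_to_linear[OF closed_comp_nonsingular[OF assms(1)]
          survivor_sets[OF assms(1)] assms(2,3) transfer_op[OF assms(1,2)]
          transfer_op[OF assms(1,3)]])
qed

lemma transfer_op_L1norm_le:
  assumes "open_system M f H" "integrable M \<phi>"
  shows "L1norm M (transfer_op M f H m \<phi>) \<le> L1norm M \<phi>"
  by (rule transfers_to_L1norm_le[OF closed_comp_nonsingular[OF assms(1)]
        survivor_sets[OF assms(1)] assms(2) transfer_op[OF assms]])

lemma transfer_op_nonneg:
  assumes "open_system M f H" "integrable M \<phi>" "AE x in M. 0 \<le> \<phi> x"
  shows "AE x in M. 0 \<le> transfer_op M f H m \<phi> x"
  by (rule transfers_to_nonneg[OF transfer_op[OF assms(1,2)] assms(3)])

lemma transfer_op_set_integral: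
  assumes "open_system M f H" "integrable M \<phi>" "A \<in> sets M"
  shows "(LINT x:A|M. transfer_op M f H m \<phi> x) = (LINT x:open_preimage f H m A|M. \<phi> x)"
  unfolding open_preimage_def
  by (rule transfers_to_set_integral[OF transfer_op[OF assms(1,2)] assms(3)])

lemma transfer_op_0:
  assumes "open_system M f H" "integrable M \<phi>"
  shows "AE x in M. transfer_op M f H 0 \<phi> x = \<phi> x"
proof (rule transfers_to_unique[OF transfer_op[OF assms]])
  show "transfers_to M (survivor f H 0) (closed_comp f 0) \<phi> \<phi>"
    using assms(2) by (simp add: transfers_to_def survivor_def set_lebesgue_integral_def)
qed

end

section \<open>Contraction of the cone over one block\<close>

lemma L1norm_cong_AE:
  assumes "integrable M p" "integrable M q" "AE x in M. p x = q x"
  shows "L1norm M p = L1norm M q"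
  unfolding L1norm_def by (rule integral_cong_AE) (use assms in auto)

lemma L1norm_eq_integral:
  assumes "integrable M p" "AE x in M. 0 \<le> p x"
  shows "L1norm M p = (LINT x|M. p x)"
  unfolding L1norm_def by (rule integral_cong_AE) (use assms in auto)

lemma L1norm_nonneg: "0 \<le> L1norm M p"
  unfolding L1norm_def by simp

lemma L1norm_add_le:
  assumes "integrable M p" "integrable M q"
  shows "L1norm M (\<lambda>x. p x + q x) \<le> L1norm M p + L1norm M q"
proof -
  have "L1norm M (\<lambda>x. p x + q x) \<le> (LINT x|M. \<bar>p x\<bar> + \<bar>q x\<bar>)"
    unfolding L1norm_def by (rule integral_mono) (use assms in auto)
  then show ?thesis using assms by (simp add: L1norm_def)
qed

lemma L1norm_cmult: "L1norm M (\<lambda>x. c * p x) = \<bar>c\<bar> * L1norm M p"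
  unfolding L1norm_def by (simp add: abs_mult)

lemma abs_integral_le_L1norm: "\<bar>LINT x|M. p x\<bar> \<le> L1norm M p"
  unfolding L1norm_def using integral_norm_bound[of M p] by simp

text \<open>With \<open>P\<close>, \<open>Q\<close> the two norms and \<open>w = p - r q\<close>,
  the difference of the normalized functions is \<open>w / P + (r / P - 1 / Q) q\<close>. The norm
  of the second summand is \<open>\<bar>r * Q - P\<bar> / P\<close>, and \<open>P - r * Q\<close> is
  the integral of \<open>w\<close>, so both summands cost the same. The free \<open>r\<close> allows
  comparison with the best multiple of \<open>q\<close>.\<close>

lemma L1norm_normalized_diff_le:
  assumes p: "integrable M p" and q: "integrable M q"
    and P: "L1norm M p = (LINT x|M. p x)" "0 < L1norm M p"
    and Q: "L1norm M q = (LINT x|M. q x)" "0 < L1norm M q"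
  shows "L1norm M (\<lambda>x. p x / L1norm M p - q x / L1norm M q)
           \<le> 2 * L1norm M (\<lambda>x. p x - r * q x) / L1norm M p"
proof -
  define P Q where "P = L1norm M p" "Q = L1norm M q"
  have pos: "0 < P" "0 < Q" using P Q by (auto simp: P_Q_def)
  define w where "w = (\<lambda>x. p x - r * q x)"
  have w: "integrable M w" using p q by (simp add: w_def)
  have "(LINT x|M. w x) = P - r * Q"
    using p q P(1) Q(1) by (simp add: w_def P_Q_def)
  then have d: "\<bar>r * Q - P\<bar> \<le> L1norm M w"
    using abs_integral_le_L1norm[of M w] by simp
  have "(\<lambda>x. p x / P - q x / Q) = (\<lambda>x. (1 / P) * w x + (r / P - 1 / Q) * q x)"
    using pos by (auto simp: w_def field_simps)
  then have "L1norm M (\<lambda>x. p x / P - q x / Q)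
      \<le> L1norm M (\<lambda>x. (1 / P) * w x) + L1norm M (\<lambda>x. (r / P - 1 / Q) * q x)"
    using L1norm_add_le[of M "\<lambda>x. (1 / P) * w x" "\<lambda>x. (r / P - 1 / Q) * q x"] w q by simp
  also have "\<dots> = L1norm M w / P + \<bar>r / P - 1 / Q\<bar> * Q"
    unfolding L1norm_cmult using pos by (simp add: P_Q_def)
  also have "\<bar>r / P - 1 / Q\<bar> * Q = \<bar>(r / P - 1 / Q) * Q\<bar>"
    using pos by (simp add: abs_mult)
  also have "(r / P - 1 / Q) * Q = (r * Q - P) / P"
    using pos by (simp add: field_simps)
  also have "L1norm M w / P + \<bar>(r * Q - P) / P\<bar> \<le> 2 * L1norm M w / P"
    using d pos by (simp add: field_simps)
  finally show ?thesis by (simp add: P_Q_def w_def)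
qed

text \<open>All that the contraction argument uses about one block. \<open>z\<^sub>1\<close> and
  \<open>z\<^sub>2\<close> are the mixing bounds, cleared of denominators; \<open>\<theta>\<close>
  is the contraction over the whole block, not over one step. \<open>D_small\<close> keeps the total
  oscillation, weighted by \<open>z\<^sub>2\<close>, below half of the lower mixing bound; the
  bounds on \<open>\<theta>\<close> and \<open>C\<close> let each Lasota--Yorke term spend an eighth
  of \<open>a * z\<^sub>1\<close> times the mass. Closure of \<open>sys\<close> under time shifts
  lets one block estimate serve all blocks.\<close>

locale mixing_block = prob_space M for M :: "'a measure" +
  fixes s :: "'a set \<Rightarrow> ('a \<Rightarrow> real) \<Rightarrow> ennreal" and M\<^sub>1 M\<^sub>2 :: real
    and \<Q> :: "'a set set" and D a z\<^sub>1 z\<^sub>2 C \<theta> :: real and T :: nat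
    and sys :: "((nat \<Rightarrow> 'a \<Rightarrow> 'a) \<times> (nat \<Rightarrow> 'a set)) set"
  assumes seminorm: "localized_seminorm M s"
    and M_pos: "0 < M\<^sub>1" "0 < M\<^sub>2"
    and strength_sum: "\<And>\<phi>. integrable M \<phi> \<Longrightarrow> s UNIV \<phi> < \<infinity> \<Longrightarrow>
          ennreal M\<^sub>1 * (\<Sum>A\<in>\<Q>. s A \<phi>) \<le> s UNIV \<phi>"
    and strength_osc: "\<And>A \<phi>. A \<in> \<Q> \<Longrightarrow> integrable M \<phi> \<Longrightarrow> s UNIV \<phi> < \<infinity> \<Longrightarrow>
          AE z in M. z \<in> A \<longrightarrow>
            ennreal (M\<^sub>2 * \<bar>1 / measure M A * (LINT x:A|M. \<phi> x) - \<phi> z\<bar>) \<le> s A \<phi>"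
    and \<Q>: "finite \<Q>" "partition_on UNIV \<Q>" "\<Q> \<subseteq> sets M"
    and measure_pos: "\<And>J. J \<in> \<Q> \<Longrightarrow> 0 < measure M J"
    and measure_le: "\<And>J. J \<in> \<Q> \<Longrightarrow> measure M J \<le> D"
    and z: "0 < z\<^sub>1" "z\<^sub>1 < 1" "1 < z\<^sub>2"
    and a_pos: "0 < a"
    and D_small: "D * a / (M\<^sub>1 * M\<^sub>2) \<le> z\<^sub>1 / (2 * z\<^sub>2)"
    and \<theta>: "0 \<le> \<theta>" "\<theta> \<le> z\<^sub>1 / 8"
    and C: "0 \<le> C" "16 * C \<le> a * z\<^sub>1"
    and T_pos: "0 < T"
    and sys_open: "\<And>f H. (f, H) \<in> sys \<Longrightarrow> open_system M f H"
    and sys_shift: "\<And>f H m. (f, H) \<in> sys \<Longrightarrow> (\<lambda>i. f (m + i), \<lambda>i. H (m + i)) \<in> sys"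
    and lasota_yorke_block: "\<And>f H \<phi>. (f, H) \<in> sys \<Longrightarrow> integrable M \<phi> \<Longrightarrow>
          s UNIV (transfer_op M f H T \<phi>) \<le> ennreal \<theta> * s UNIV \<phi> + ennreal (C * L1norm M \<phi>)"
    and mixing_block: "\<And>f H J\<^sub>1 J\<^sub>2. (f, H) \<in> sys \<Longrightarrow> J\<^sub>1 \<in> \<Q> \<Longrightarrow> J\<^sub>2 \<in> \<Q> \<Longrightarrow>
          z\<^sub>1 * (measure M J\<^sub>1 * measure M J\<^sub>2) \<le> measure M (J\<^sub>1 \<inter> open_preimage f H T J\<^sub>2) \<and>
          measure M (J\<^sub>1 \<inter> open_preimage f H T J\<^sub>2) \<le> z\<^sub>2 * (measure M J\<^sub>1 * measure M J\<^sub>2)"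
begin

text \<open>Unlike \<^const>\<open>density_cone\<close>, this cone imposes no sign, so that it is enough to control
  averages over \<open>\<Q>\<close> to see that a difference of two members is again a member.\<close>

definition average_cone :: "('a \<Rightarrow> real) set" where
  "average_cone = {\<phi>. integrable M \<phi> \<and> s UNIV \<phi> < \<infinity> \<and>
     (\<forall>J\<in>\<Q>. enn2real (s UNIV \<phi>) * measure M J \<le> a * (LINT x:J|M. \<phi> x))}"

lemma average_coneD:
  assumes "\<phi> \<in> average_cone"
  shows "integrable M \<phi>" "s UNIV \<phi> < \<infinity>"
    and "J \<in> \<Q> \<Longrightarrow> enn2real (s UNIV \<phi>) * measure M J \<le> a * (LINT x:J|M. \<phi> x)"
  using assms by (auto simp: average_cone_def)

lemma UNIV_sets: "UNIV \<in> sets M" "space M = UNIV"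
proof -
  have "UNIV = \<Union>\<Q>" using \<Q>(2) by (simp add: partition_on_def)
  then show "UNIV \<in> sets M" using \<Q> by (metis sets.finite_Union)
  then show "space M = UNIV" using sets.sets_into_space by blast
qed

lemmas seminorm_UNIV = bspec[OF seminorm[unfolded localized_seminorm_def] UNIV_sets(1)]

lemma seminorm_cong_AE:
  assumes "integrable M \<phi>" "integrable M \<psi>" "AE x in M. \<phi> x = \<psi> x"
  shows "s UNIV \<phi> = s UNIV \<psi>"
  by (rule conjunct1[OF seminorm_UNIV, rule_format, OF assms(1,2)]) (use assms(3) in auto)

lemma seminorm_add:
  assumes "integrable M \<phi>" "integrable M \<psi>"
  shows "s UNIV (\<lambda>x. \<phi> x + \<psi> x) \<le> s UNIV \<phi> + s UNIV \<psi>"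
  by (rule conjunct1[OF conjunct2[OF seminorm_UNIV], rule_format, OF assms])

lemma seminorm_cmult:
  assumes "integrable M \<phi>"
  shows "s UNIV (\<lambda>x. c * \<phi> x) = ennreal \<bar>c\<bar> * s UNIV \<phi>"
  by (rule conjunct2[OF conjunct2[OF seminorm_UNIV], rule_format, OF assms])

lemma sum_set_integral:
  fixes \<phi> :: "'a \<Rightarrow> real"
  assumes "integrable M \<phi>" "S \<in> sets M"
  shows "(\<Sum>J\<in>\<Q>. LINT x:J \<inter> S|M. \<phi> x) = (LINT x:S|M. \<phi> x)"
proof -
  have "(\<Sum>J\<in>\<Q>. LINT x:J \<inter> S|M. \<phi> x) = (LINT x:(\<Union>J\<in>\<Q>. J \<inter> S)|M. \<phi> x)"
  proof (rule set_integral_finite_Union[where A = "\<lambda>J. J \<inter> S", symmetric])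
    show "disjoint_family_on (\<lambda>J. J \<inter> S) \<Q>"
      using \<Q>(2) by (auto simp: disjoint_family_on_def partition_on_def disjoint_def)
    show "set_integrable M (J \<inter> S) \<phi>" if "J \<in> \<Q>" for J
      unfolding set_integrable_def
      by (rule integrable_mult_indicator) (use that \<Q> assms in auto)
  qed (use \<Q> assms in auto)
  also have "(\<Union>J\<in>\<Q>. J \<inter> S) = S"
    using \<Q>(2) by (auto simp: partition_on_def)
  finally show ?thesis .
qed

lemma sum_integral:
  fixes \<phi> :: "'a \<Rightarrow> real"
  assumes "integrable M \<phi>"
  shows "(\<Sum>J\<in>\<Q>. LINT x:J|M. \<phi> x) = (LINT x|M. \<phi> x)"
  using sum_set_integral[OF assms UNIV_sets(1)] by (simp add: set_lebesgue_integral_def)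

lemma sum_measure: "(\<Sum>J\<in>\<Q>. measure M J) = 1"
proof -
  have "(\<Sum>J\<in>\<Q>. measure M J) = (\<Sum>J\<in>\<Q>. LINT x:J|M. 1)"
    by (rule sum.cong) (use \<Q> in \<open>auto simp: set_lebesgue_integral_def\<close>)
  also have "\<dots> = (LINT x|M. 1)" by (rule sum_integral) simp
  finally show ?thesis using prob_space by simp
qed

section \<open>Mass, seminorm and oscillation of a member of the cone\<close>

lemma average_cone_set_integral_nonneg:
  assumes "\<phi> \<in> average_cone" "J \<in> \<Q>"
  shows "0 \<le> (LINT x:J|M. \<phi> x)"
proof -
  have "0 \<le> enn2real (s UNIV \<phi>) * measure M J" by simp
  also have "\<dots> \<le> a * (LINT x:J|M. \<phi> x)" using assms average_coneD by blast
  finally show ?thesis using a_pos by (simp add: zero_le_mult_iff)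
qed

lemma average_cone_integral_nonneg:
  assumes "\<phi> \<in> average_cone"
  shows "0 \<le> (LINT x|M. \<phi> x)"
  using average_cone_set_integral_nonneg[OF assms]
  by (subst sum_integral[symmetric]) (auto intro: sum_nonneg average_coneD assms)

text \<open>Summing the cone inequality over the atoms, whose measures add up to 1, replaces local
  averages by the total mass.\<close>

lemma average_cone_seminorm_le:
  assumes "\<phi> \<in> average_cone"
  shows "enn2real (s UNIV \<phi>) \<le> a * (LINT x|M. \<phi> x)"
proof -
  have "enn2real (s UNIV \<phi>) = (\<Sum>J\<in>\<Q>. enn2real (s UNIV \<phi>) * measure M J)"
    by (simp add: sum_distrib_left[symmetric] sum_measure)
  also have "\<dots> \<le> (\<Sum>J\<in>\<Q>. a * (LINT x:J|M. \<phi> x))"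
    by (rule sum_mono) (use assms average_coneD in auto)
  also have "\<dots> = a * (LINT x|M. \<phi> x)"
    by (simp add: sum_distrib_left[symmetric] sum_integral[OF average_coneD(1)[OF assms]])
  finally show ?thesis .
qed

text \<open>\<open>\<sigma> J\<close> is the oscillation bound given by the local seminorm on
  \<open>J\<close>. The local seminorms are summable against the global one, which the cone bounds
  by \<open>a\<close> times the mass; each weight \<open>measure M J\<close> is at most
  \<open>D\<close>. The resulting factor is the left side of \<open>D_small\<close>.\<close>

lemma average_cone_oscillation:
  assumes \<phi>: "\<phi> \<in> average_cone"
  obtains \<sigma> where "\<And>J. J \<in> \<Q> \<Longrightarrow> 0 \<le> \<sigma> J"
    and "\<And>J. J \<in> \<Q> \<Longrightarrow>
      AE x in M. x \<in> J \<longrightarrow> \<bar>(LINT x:J|M. \<phi> x) / measure M J - \<phi> x\<bar> \<le> \<sigma> J"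
    and "(\<Sum>J\<in>\<Q>. measure M J * \<sigma> J) \<le> z\<^sub>1 / (2 * z\<^sub>2) * (LINT x|M. \<phi> x)"
proof
  define \<sigma> where "\<sigma> = (\<lambda>J. enn2real (s J \<phi>) / M\<^sub>2)"
  note int = average_coneD(1)[OF \<phi>] and fin = average_coneD(2)[OF \<phi>]
  have le: "ennreal M\<^sub>1 * (\<Sum>J\<in>\<Q>. s J \<phi>) \<le> s UNIV \<phi>"
    by (rule strength_sum[OF int fin])
  have "(\<Sum>J\<in>\<Q>. s J \<phi>) < \<infinity>"
  \<comment> \<open>As \<open>M\<^sub>1\<close> is positive, an infinite sum would force the global
    seminorm to be infinite, contrary to membership in the cone.\<close>
  proof (rule ccontr)
    assume "\<not> ?thesis"
    then have "(\<Sum>J\<in>\<Q>. s J \<phi>) = \<infinity>"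
      unfolding infinity_ennreal_def using top.not_eq_extremum by blast
    with le fin M_pos show False by (simp add: ennreal_mult_top)
  qed
  then have sfin: "s J \<phi> < \<infinity>" if "J \<in> \<Q>" for J
    using member_le_sum[OF that, of "\<lambda>J. s J \<phi>"] \<Q>(1) by (auto intro: order_le_less_trans)
  show \<sigma>0: "0 \<le> \<sigma> J" for J
    using M_pos by (simp add: \<sigma>_def)
  show "AE x in M. x \<in> J \<longrightarrow> \<bar>(LINT x:J|M. \<phi> x) / measure M J - \<phi> x\<bar> \<le> \<sigma> J" if J: "J \<in> \<Q>" for J
    using strength_osc[OF J int fin]
  proof eventually_elim
    case (elim x)
    show ?case
    proof
      assume "x \<in> J"
      with elim have "ennreal (M\<^sub>2 * \<bar>1 / measure M J * (LINT x:J|M. \<phi> x) - \<phi> x\<bar>) \<le> s J \<phi>" by simp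
      from enn2real_mono[OF this] sfin[OF J]
      have "M\<^sub>2 * \<bar>1 / measure M J * (LINT x:J|M. \<phi> x) - \<phi> x\<bar> \<le> enn2real (s J \<phi>)"
        using M_pos by (simp add: enn2real_ennreal less_top)
      then show "\<bar>(LINT x:J|M. \<phi> x) / measure M J - \<phi> x\<bar> \<le> \<sigma> J"
        using M_pos by (simp add: \<sigma>_def field_simps)
    qed
  qed
  have "(\<Sum>J\<in>\<Q>. s J \<phi>) = (\<Sum>J\<in>\<Q>. ennreal (enn2real (s J \<phi>)))"
    by (rule sum.cong) (use sfin in \<open>auto simp: less_top\<close>)
  also have "\<dots> = ennreal (\<Sum>J\<in>\<Q>. enn2real (s J \<phi>))" by (rule sum_ennreal) simp
  finally have "ennreal (M\<^sub>1 * (\<Sum>J\<in>\<Q>. enn2real (s J \<phi>))) \<le> s UNIV \<phi>"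
    using le M_pos by (simp add: ennreal_mult' sum_nonneg)
  from enn2real_mono[OF this] fin
  have S: "M\<^sub>1 * (\<Sum>J\<in>\<Q>. enn2real (s J \<phi>)) \<le> enn2real (s UNIV \<phi>)"
    using M_pos by (simp add: less_top sum_nonneg)
  \<comment> \<open>The atoms have total measure 1, so there is at least one, and its measure lies
    between 0 and \<open>D\<close>.\<close>
  have D0: "0 \<le> D"
  proof -
    obtain J where "J \<in> \<Q>" using sum_measure by fastforce
    then show ?thesis using measure_pos measure_le by force
  qed
  have "(\<Sum>J\<in>\<Q>. measure M J * \<sigma> J) \<le> (\<Sum>J\<in>\<Q>. D * \<sigma> J)"
    by (intro sum_mono mult_right_mono measure_le \<sigma>0)
  also have "\<dots> = D / (M\<^sub>1 * M\<^sub>2) * (M\<^sub>1 * (\<Sum>J\<in>\<Q>. enn2real (s J \<phi>)))"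
    using M_pos by (simp add: \<sigma>_def sum_distrib_left sum_divide_distrib field_simps)
  also have "\<dots> \<le> D / (M\<^sub>1 * M\<^sub>2) * (a * (LINT x|M. \<phi> x))"
    by (rule mult_left_mono[OF order_trans[OF S average_cone_seminorm_le[OF \<phi>]]])
       (use D0 M_pos in auto)
  also have "\<dots> = D * a / (M\<^sub>1 * M\<^sub>2) * (LINT x|M. \<phi> x)" by simp
  also have "\<dots> \<le> z\<^sub>1 / (2 * z\<^sub>2) * (LINT x|M. \<phi> x)"
    by (intro mult_right_mono D_small average_cone_integral_nonneg \<phi>)
  finally show "(\<Sum>J\<in>\<Q>. measure M J * \<sigma> J) \<le> z\<^sub>1 / (2 * z\<^sub>2) * (LINT x|M. \<phi> x)" .
qed

text \<open>On an atom, \<open>\<bar>\<phi>\<bar>\<close> is at most the mean, which is nonnegative,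
  plus the oscillation. All oscillations together cost at most one more total mass. Thus members of
  the cone behave like nonnegative functions up to a factor 2.\<close>

lemma average_cone_L1norm_le:
  assumes \<phi>: "\<phi> \<in> average_cone"
  shows "L1norm M \<phi> \<le> 2 * (LINT x|M. \<phi> x)"
proof -
  obtain \<sigma> where \<sigma>0: "\<And>J. J \<in> \<Q> \<Longrightarrow> 0 \<le> \<sigma> J"
    and osc: "\<And>J. J \<in> \<Q> \<Longrightarrow>
      AE x in M. x \<in> J \<longrightarrow> \<bar>(LINT x:J|M. \<phi> x) / measure M J - \<phi> x\<bar> \<le> \<sigma> J"
    and sum: "(\<Sum>J\<in>\<Q>. measure M J * \<sigma> J) \<le> z\<^sub>1 / (2 * z\<^sub>2) * (LINT x|M. \<phi> x)"
    using average_cone_oscillation[OF \<phi>] by blast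
  note int = average_coneD(1)[OF \<phi>]
  have "(LINT x:J|M. \<bar>\<phi> x\<bar>) \<le> (LINT x:J|M. \<phi> x) + measure M J * \<sigma> J" if J: "J \<in> \<Q>" for J
  proof -
    define A where "A = (LINT x:J|M. \<phi> x) / measure M J"
    have [simp]: "J \<in> sets M" using J \<Q> by auto
    have A: "0 \<le> A" using average_cone_set_integral_nonneg[OF \<phi> J] by (simp add: A_def)
    have "(LINT x:J|M. \<bar>\<phi> x\<bar>) \<le> (LINT x|M. indicator J x * (A + \<sigma> J))"
      unfolding set_lebesgue_integral_def
    proof (rule integral_mono_AE)
      show "integrable M (\<lambda>x. indicat_real J x *\<^sub>R \<bar>\<phi> x\<bar>)"
        using int by (intro integrable_mult_indicator) auto
      show "AE x in M. indicat_real J x *\<^sub>R \<bar>\<phi> x\<bar> \<le> indicat_real J x * (A + \<sigma> J)"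
        using osc[OF J] by eventually_elim (use A in \<open>auto simp: indicator_def A_def[symmetric]\<close>)
    qed (simp add: integrable_real_indicator emeasure_finite less_top[symmetric])
    also have "\<dots> = measure M J * (A + \<sigma> J)" by simp
    also have "\<dots> = (LINT x:J|M. \<phi> x) + measure M J * \<sigma> J"
      using measure_pos[OF J] by (simp add: A_def field_simps)
    finally show ?thesis .
  qed
  then have "(\<Sum>J\<in>\<Q>. LINT x:J|M. \<bar>\<phi> x\<bar>) \<le> (\<Sum>J\<in>\<Q>. (LINT x:J|M. \<phi> x) + measure M J * \<sigma> J)"
    by (rule sum_mono)
  then have "L1norm M \<phi> \<le> (LINT x|M. \<phi> x) + (\<Sum>J\<in>\<Q>. measure M J * \<sigma> J)"
    using sum_integral[OF int] sum_integral[of "\<lambda>x. \<bar>\<phi> x\<bar>"] int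
    by (simp add: L1norm_def sum.distrib)
  also have "(\<Sum>J\<in>\<Q>. measure M J * \<sigma> J) \<le> 1 * (LINT x|M. \<phi> x)"
    by (rule order_trans[OF sum mult_right_mono])
       (use z average_cone_integral_nonneg[OF \<phi>] in \<open>auto simp: field_simps\<close>)
  finally show ?thesis by simp
qed

text \<open>By duality the integral over \<open>K\<close> is that of \<open>\<phi>\<close> over the
  open preimage \<open>P\<close> of \<open>K\<close>. On each atom \<open>J\<close>,
  \<open>\<phi>\<close> is its mean up to \<open>\<sigma> J\<close>, and mixing compares the measure
  of \<open>J \<inter> P\<close> with the product of the measures of \<open>J\<close> and
  \<open>K\<close>. The oscillations consume half of the lower mixing bound.\<close>

lemma block_set_integral:
  assumes \<phi>: "\<phi> \<in> average_cone" and fH: "(f, H) \<in> sys" and K: "K \<in> \<Q>"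
  shows "z\<^sub>1 / 2 * (LINT x|M. \<phi> x) * measure M K \<le> (LINT x:K|M. transfer_op M f H T \<phi> x)"
    and "(LINT x:K|M. transfer_op M f H T \<phi> x) \<le> 2 * z\<^sub>2 * (LINT x|M. \<phi> x) * measure M K"
proof -
  obtain \<sigma> where \<sigma>0: "\<And>J. J \<in> \<Q> \<Longrightarrow> 0 \<le> \<sigma> J"
    and osc: "\<And>J. J \<in> \<Q> \<Longrightarrow>
      AE x in M. x \<in> J \<longrightarrow> \<bar>(LINT x:J|M. \<phi> x) / measure M J - \<phi> x\<bar> \<le> \<sigma> J"
    and sum: "(\<Sum>J\<in>\<Q>. measure M J * \<sigma> J) \<le> z\<^sub>1 / (2 * z\<^sub>2) * (LINT x|M. \<phi> x)"
    using average_cone_oscillation[OF \<phi>] by blast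
  note int = average_coneD(1)[OF \<phi>]
  define P where "P = open_preimage f H T K"
  define k where "k = measure M K"
  note os = sys_open[OF fH]
  have P[measurable]: "P \<in> sets M"
  proof -
    have "closed_comp f T -` K \<inter> space M \<in> sets M"
      using closed_comp_nonsingular[OF os] K \<Q> by (intro measurable_sets) (auto simp: nonsingular_def)
    moreover have "P = survivor f H T \<inter> (closed_comp f T -` K \<inter> space M)"
      by (auto simp: P_def open_preimage_def UNIV_sets)
    ultimately show ?thesis using survivor_sets[OF os] by simp
  qed
  have k0: "0 < k" using measure_pos[OF K] by (simp add: k_def)
  \<comment> \<open>The nonnegative mean is weighted with \<open>z\<^sub>1\<close> below and with
    \<open>z\<^sub>2\<close> above, whereas the error carries \<open>z\<^sub>2\<close> on both
    sides: to subtract an error safely, the measure of \<open>J \<inter> P\<close> must be bounded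
    from above.\<close>
  have bounds: "k * (z\<^sub>1 * (LINT x:J|M. \<phi> x) - z\<^sub>2 * (measure M J * \<sigma> J)) \<le> (LINT x:J \<inter> P|M. \<phi> x) \<and>
      (LINT x:J \<inter> P|M. \<phi> x) \<le> k * (z\<^sub>2 * (LINT x:J|M. \<phi> x) + z\<^sub>2 * (measure M J * \<sigma> J))"
    if J: "J \<in> \<Q>" for J
  proof -
    define A where "A = (LINT x:J|M. \<phi> x) / measure M J"
    define \<mu> where "\<mu> = measure M (J \<inter> P)"
    define j where "j = measure M J"
    have [measurable]: "J \<in> sets M" using J \<Q> by auto
    have j0: "0 < j" using measure_pos[OF J] by (simp add: j_def)
    have A: "0 \<le> A" using average_cone_set_integral_nonneg[OF \<phi> J] by (simp add: A_def)
    have Aj: "(LINT x:J|M. \<phi> x) = A * j" using j0 by (simp add: A_def j_def)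
    have \<mu>: "z\<^sub>1 * (j * k) \<le> \<mu>" "\<mu> \<le> z\<^sub>2 * (j * k)"
      using mixing_block[OF fH J K] by (auto simp: \<mu>_def j_def k_def P_def)
    have i: "integrable M (\<lambda>x. indicat_real (J \<inter> P) x *\<^sub>R \<phi> x)"
      using int by (intro integrable_mult_indicator) auto
    have "(LINT x|M. indicator (J \<inter> P) x * (A - \<sigma> J)) \<le> (LINT x:J \<inter> P|M. \<phi> x)"
      unfolding set_lebesgue_integral_def
    proof (rule integral_mono_AE[OF _ i])
      show "AE x in M. indicat_real (J \<inter> P) x * (A - \<sigma> J) \<le> indicat_real (J \<inter> P) x *\<^sub>R \<phi> x"
        using osc[OF J] by eventually_elim (auto simp: indicator_def A_def[symmetric])
    qed (simp add: integrable_real_indicator emeasure_finite less_top[symmetric])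
    then have lo: "\<mu> * (A - \<sigma> J) \<le> (LINT x:J \<inter> P|M. \<phi> x)" by (simp add: \<mu>_def)
    have "(LINT x:J \<inter> P|M. \<phi> x) \<le> (LINT x|M. indicator (J \<inter> P) x * (A + \<sigma> J))"
      unfolding set_lebesgue_integral_def
    proof (rule integral_mono_AE[OF i])
      show "AE x in M. indicat_real (J \<inter> P) x *\<^sub>R \<phi> x \<le> indicat_real (J \<inter> P) x * (A + \<sigma> J)"
        using osc[OF J] by eventually_elim (auto simp: indicator_def A_def[symmetric])
    qed (simp add: integrable_real_indicator emeasure_finite less_top[symmetric])
    then have hi: "(LINT x:J \<inter> P|M. \<phi> x) \<le> \<mu> * (A + \<sigma> J)" by (simp add: \<mu>_def)
    have "z\<^sub>1 * (j * k) * A \<le> \<mu> * A" "\<mu> * A \<le> z\<^sub>2 * (j * k) * A"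
      "\<mu> * \<sigma> J \<le> z\<^sub>2 * (j * k) * \<sigma> J"
      using \<mu> A \<sigma>0[OF J] by (intro mult_right_mono; simp)+
    with lo hi show ?thesis
      unfolding Aj by (simp add: j_def[symmetric] algebra_simps)
  qed
  define I R where "I = (LINT x|M. \<phi> x)" "R = (\<Sum>J\<in>\<Q>. measure M J * \<sigma> J)"
  have I0: "0 \<le> I" unfolding I_R_def by (rule average_cone_integral_nonneg[OF \<phi>])
  have R: "z\<^sub>2 * R \<le> z\<^sub>1 / 2 * I"
    using sum z unfolding I_R_def[symmetric] by (simp add: field_simps)
  have eq: "(LINT x:K|M. transfer_op M f H T \<phi> x) = (\<Sum>J\<in>\<Q>. LINT x:J \<inter> P|M. \<phi> x)"
    using transfer_op_set_integral[OF os int, of K T] K \<Q> sum_set_integral[OF int P]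
    by (auto simp: P_def)
  have "k * (z\<^sub>1 * I - z\<^sub>2 * R) = (\<Sum>J\<in>\<Q>. k * (z\<^sub>1 * (LINT x:J|M. \<phi> x) - z\<^sub>2 * (measure M J * \<sigma> J)))"
    by (simp add: I_R_def sum_integral[OF int, symmetric] sum_distrib_left[symmetric] sum_subtractf)
  also have "\<dots> \<le> (LINT x:K|M. transfer_op M f H T \<phi> x)"
    unfolding eq by (rule sum_mono) (use bounds in blast)
  finally have 1: "k * (z\<^sub>1 * I - z\<^sub>2 * R) \<le> (LINT x:K|M. transfer_op M f H T \<phi> x)" .
  have "(LINT x:K|M. transfer_op M f H T \<phi> x)
      \<le> (\<Sum>J\<in>\<Q>. k * (z\<^sub>2 * (LINT x:J|M. \<phi> x) + z\<^sub>2 * (measure M J * \<sigma> J)))"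
    unfolding eq by (rule sum_mono) (use bounds in blast)
  also have "\<dots> = k * (z\<^sub>2 * I + z\<^sub>2 * R)"
    by (simp add: I_R_def sum_integral[OF int, symmetric] sum_distrib_left[symmetric] sum.distrib)
  finally have 2: "(LINT x:K|M. transfer_op M f H T \<phi> x) \<le> k * (z\<^sub>2 * I + z\<^sub>2 * R)" .
  have "k * (z\<^sub>1 / 2 * I) \<le> k * (z\<^sub>1 * I - z\<^sub>2 * R)"
    using R k0 by (intro mult_left_mono) linarith+
  from order_trans[OF this 1] show "z\<^sub>1 / 2 * (LINT x|M. \<phi> x) * measure M K \<le> (LINT x:K|M. transfer_op M f H T \<phi> x)"
    by (simp add: I_R_def[symmetric] k_def[symmetric] mult_ac)
  have "z\<^sub>1 / 2 * I \<le> z\<^sub>2 * I" using z I0 by (intro mult_right_mono) auto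
  with R have "k * (z\<^sub>2 * I + z\<^sub>2 * R) \<le> k * (2 * z\<^sub>2 * I)"
    using k0 by (intro mult_left_mono) linarith+
  from order_trans[OF 2 this] show "(LINT x:K|M. transfer_op M f H T \<phi> x) \<le> 2 * z\<^sub>2 * (LINT x|M. \<phi> x) * measure M K"
    by (simp add: I_R_def[symmetric] k_def[symmetric] mult_ac)
qed

lemma block_integral:
  assumes \<phi>: "\<phi> \<in> average_cone" and fH: "(f, H) \<in> sys"
  shows "z\<^sub>1 / 2 * (LINT x|M. \<phi> x) \<le> (LINT x|M. transfer_op M f H T \<phi> x)"
proof -
  have int: "integrable M (transfer_op M f H T \<phi>)"
    using transfer_op_integrable sys_open[OF fH] average_coneD(1)[OF \<phi>] by blast
  have "(\<Sum>K\<in>\<Q>. z\<^sub>1 / 2 * (LINT x|M. \<phi> x) * measure M K)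
      \<le> (\<Sum>K\<in>\<Q>. LINT x:K|M. transfer_op M f H T \<phi> x)"
    by (rule sum_mono) (rule block_set_integral[OF \<phi> fH])
  then show ?thesis
    unfolding sum_integral[OF int] sum_distrib_left[symmetric] sum_measure by simp
qed

text \<open>The two Lasota--Yorke terms contribute \<open>a * z\<^sub>1 / 8\<close> each. Since all
  averages of the image are at least \<open>z\<^sub>1 / 2\<close> times the mass, the image
  satisfies the cone inequality with \<open>a / 2\<close>; the slack is what allows a second image
  to be subtracted.\<close>

lemma block_seminorm:
  assumes \<phi>: "\<phi> \<in> average_cone" and fH: "(f, H) \<in> sys"
  shows "s UNIV (transfer_op M f H T \<phi>) \<le> ennreal (a * z\<^sub>1 / 4 * (LINT x|M. \<phi> x))"
proof -
  define I where "I = (LINT x|M. \<phi> x)"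
  have I0: "0 \<le> I" unfolding I_def by (rule average_cone_integral_nonneg[OF \<phi>])
  have "s UNIV (transfer_op M f H T \<phi>) \<le> ennreal \<theta> * s UNIV \<phi> + ennreal (C * L1norm M \<phi>)"
    by (rule lasota_yorke_block[OF fH average_coneD(1)[OF \<phi>]])
  also have "s UNIV \<phi> = ennreal (enn2real (s UNIV \<phi>))"
    using average_coneD(2)[OF \<phi>] by (simp add: less_top)
  also have "ennreal \<theta> * ennreal (enn2real (s UNIV \<phi>)) + ennreal (C * L1norm M \<phi>)
      = ennreal (\<theta> * enn2real (s UNIV \<phi>) + C * L1norm M \<phi>)"
    using \<theta> C by (simp add: ennreal_mult' L1norm_nonneg)
  also have "\<dots> \<le> ennreal (a * z\<^sub>1 / 4 * I)"
  proof (rule ennreal_leI)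
    have "\<theta> * enn2real (s UNIV \<phi>) \<le> z\<^sub>1 / 8 * (a * I)"
      using \<theta> z average_cone_seminorm_le[OF \<phi>] by (intro mult_mono) (auto simp: I_def)
    moreover have "C * L1norm M \<phi> \<le> (a * z\<^sub>1 / 16) * (2 * I)"
      using C average_cone_L1norm_le[OF \<phi>] by (intro mult_mono) (auto simp: I_def L1norm_nonneg)
    moreover have "z\<^sub>1 / 8 * (a * I) + (a * z\<^sub>1 / 16) * (2 * I) = a * z\<^sub>1 / 4 * I" by simp
    ultimately show "\<theta> * enn2real (s UNIV \<phi>) + C * L1norm M \<phi> \<le> a * z\<^sub>1 / 4 * I" by linarith
  qed
  finally show ?thesis by (simp add: I_def)
qed

section \<open>Subtracting one block image from another within the cone\<close>

lemma average_cone_cong_AE: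
  assumes "\<phi> \<in> average_cone" "integrable M \<psi>" "AE x in M. \<phi> x = \<psi> x"
  shows "\<psi> \<in> average_cone"
proof -
  note int = average_coneD(1)[OF assms(1)]
  have "s UNIV \<phi> = s UNIV \<psi>"
    by (rule seminorm_cong_AE[OF int assms(2,3)])
  moreover have "(LINT x:J|M. \<phi> x) = (LINT x:J|M. \<psi> x)" if "J \<in> \<Q>" for J
    using that \<Q> int assms(2,3) by (intro set_lebesgue_integral_cong_AE) auto
  ultimately show ?thesis using assms by (auto simp: average_cone_def)
qed

lemma average_cone_cmult:
  assumes "\<phi> \<in> average_cone" "0 \<le> c"
  shows "(\<lambda>x. c * \<phi> x) \<in> average_cone"
proof -
  note \<phi> = average_coneD[OF assms(1)]
  have s: "s UNIV (\<lambda>x. c * \<phi> x) = ennreal c * s UNIV \<phi>"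
    using seminorm_cmult[OF \<phi>(1), of c] assms(2) by simp
  have "c * (enn2real (s UNIV \<phi>) * measure M J) \<le> c * (a * (LINT x:J|M. \<phi> x))" if "J \<in> \<Q>" for J
    using \<phi>(3)[OF that] assms(2) by (rule mult_left_mono)
  moreover have "enn2real (s UNIV (\<lambda>x. c * \<phi> x)) = c * enn2real (s UNIV \<phi>)"
    using assms(2) by (simp add: s enn2real_mult)
  moreover have "s UNIV (\<lambda>x. c * \<phi> x) < \<infinity>"
    using \<phi>(2) by (simp add: s ennreal_mult_less_top)
  ultimately show ?thesis
    using \<phi>(1) by (simp add: average_cone_def mult_ac)
qed

text \<open>The largest \<open>r\<close> with \<open>z\<^sub>1 / 4 * (1 + r) \<le> z\<^sub>1 / 2 - 2
  * z\<^sub>2 * r\<close>. The left side measures the seminorm of a difference of two block images,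
  the right side its averages.\<close>

definition rate :: real where
  "rate = z\<^sub>1 / (z\<^sub>1 + 8 * z\<^sub>2)"

lemma rate: "0 < rate" "rate < 1"
  using z by (auto simp: rate_def field_simps)

text \<open>With masses \<open>X\<close>, \<open>Y\<close> of the inputs and
  \<open>b = rate * \<kappa>\<close>, the seminorm of the difference is at most
  \<open>a * z\<^sub>1 / 4 * (X + b * Y)\<close> and its averages are at least
  \<open>z\<^sub>1 / 2 * X - 2 * z\<^sub>2 * b * Y\<close>. The hypothesis on masses gives
  \<open>b * Y \<le> rate * X\<close>, and \<open>rate\<close> is tuned to make this
  sufficient.\<close>

lemma block_difference_in_cone:
  assumes x: "x \<in> average_cone" and y: "y \<in> average_cone" and fH: "(f, H) \<in> sys"
    and \<kappa>: "0 \<le> \<kappa>" "\<kappa> * (LINT t|M. y t) \<le> (LINT t|M. x t)"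
  shows "(\<lambda>t. transfer_op M f H T x t - rate * \<kappa> * transfer_op M f H T y t) \<in> average_cone"
proof -
  define X Y where "X = (LINT t|M. x t)" "Y = (LINT t|M. y t)"
  define Lx Ly where "Lx = transfer_op M f H T x" "Ly = transfer_op M f H T y"
  define b where "b = rate * \<kappa>"
  note os = sys_open[OF fH]
  have int: "integrable M Lx" "integrable M Ly"
    unfolding Lx_Ly_def using transfer_op_integrable[OF os] average_coneD(1) x y by auto
  have X0: "0 \<le> X" and Y0: "0 \<le> Y"
    unfolding X_Y_def using average_cone_integral_nonneg x y by auto
  have b0: "0 \<le> b" using rate \<kappa> by (simp add: b_def)
  have bY: "b * Y \<le> rate * X"
    using mult_left_mono[OF \<kappa>(2), of rate] rate by (simp add: b_def X_Y_def mult_ac)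
  have "s UNIV (\<lambda>t. Lx t + (- b) * Ly t) \<le> s UNIV Lx + s UNIV (\<lambda>t. (- b) * Ly t)"
    by (rule seminorm_add) (use int in auto)
  also have "s UNIV (\<lambda>t. (- b) * Ly t) = ennreal \<bar>- b\<bar> * s UNIV Ly"
    by (rule seminorm_cmult[OF int(2)])
  also have "s UNIV Lx + ennreal \<bar>- b\<bar> * s UNIV Ly
      \<le> ennreal (a * z\<^sub>1 / 4 * X) + ennreal b * ennreal (a * z\<^sub>1 / 4 * Y)"
    unfolding Lx_Ly_def X_Y_def using block_seminorm[OF x fH] block_seminorm[OF y fH] b0
    by (intro add_mono mult_mono) auto
  also have "\<dots> = ennreal (a * z\<^sub>1 / 4 * (X + b * Y))"
    using b0 X0 Y0 a_pos z by (simp add: ennreal_mult'[symmetric] ennreal_plus[symmetric] algebra_simps del: ennreal_plus)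
  finally have s: "s UNIV (\<lambda>t. Lx t - b * Ly t) \<le> ennreal (a * z\<^sub>1 / 4 * (X + b * Y))"
    by simp
  have fin: "s UNIV (\<lambda>t. Lx t - b * Ly t) < \<infinity>"
    using s by (rule order_le_less_trans) simp
  have S: "enn2real (s UNIV (\<lambda>t. Lx t - b * Ly t)) \<le> a * z\<^sub>1 / 4 * (X + b * Y)"
    using enn2real_mono[OF s] a_pos z X0 Y0 b0 by simp
  have "enn2real (s UNIV (\<lambda>t. Lx t - b * Ly t)) * measure M J \<le> a * (LINT t:J|M. Lx t - b * Ly t)"
    if J: "J \<in> \<Q>" for J
  proof -
    define j where "j = measure M J"
    have j0: "0 < j" using measure_pos[OF J] by (simp add: j_def)
    have si: "set_integrable M J Lx" "set_integrable M J Ly"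
      unfolding set_integrable_def using J \<Q> by (intro integrable_mult_indicator int; auto)+
    have 1: "z\<^sub>1 / 2 * X * j \<le> (LINT t:J|M. Lx t)"
      unfolding X_Y_def Lx_Ly_def j_def by (rule block_set_integral[OF x fH J])
    have 2: "(LINT t:J|M. Ly t) \<le> 2 * z\<^sub>2 * Y * j"
      unfolding X_Y_def Lx_Ly_def j_def by (rule block_set_integral[OF y fH J])
    have 3: "z\<^sub>1 / 4 * (X + b * Y) \<le> z\<^sub>1 / 2 * X - 2 * z\<^sub>2 * (b * Y)"
    proof -
      have "(z\<^sub>1 + 8 * z\<^sub>2) * (b * Y) \<le> (z\<^sub>1 + 8 * z\<^sub>2) * (rate * X)"
        using bY z by (intro mult_left_mono) auto
      also have "\<dots> = z\<^sub>1 * X" using z by (simp add: rate_def)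
      finally show ?thesis by (simp add: field_simps)
    qed
    have "enn2real (s UNIV (\<lambda>t. Lx t - b * Ly t)) * j \<le> a * z\<^sub>1 / 4 * (X + b * Y) * j"
      using S j0 by (intro mult_right_mono) auto
    also have "\<dots> = a * j * (z\<^sub>1 / 4 * (X + b * Y))" by simp
    also have "\<dots> \<le> a * j * (z\<^sub>1 / 2 * X - 2 * z\<^sub>2 * (b * Y))"
      using 3 a_pos j0 by (intro mult_left_mono) auto
    also have "\<dots> = a * (z\<^sub>1 / 2 * X * j - b * (2 * z\<^sub>2 * Y * j))" by (simp add: algebra_simps)
    also have "\<dots> \<le> a * ((LINT t:J|M. Lx t) - b * (LINT t:J|M. Ly t))"
      using 1 2 a_pos b0 by (intro mult_left_mono diff_mono) auto
    also have "\<dots> = a * (LINT t:J|M. Lx t - b * Ly t)"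
      using si by (subst set_integral_diff) auto
    finally show ?thesis by (simp add: j_def)
  qed
  then have "(\<lambda>t. Lx t - b * Ly t) \<in> average_cone"
    using int fin by (simp add: average_cone_def)
  then show ?thesis by (simp add: Lx_Ly_def b_def)
qed

lemma block_in_cone:
  assumes "x \<in> average_cone" "(f, H) \<in> sys"
  shows "transfer_op M f H T x \<in> average_cone"
  using block_difference_in_cone[OF assms(1) assms(1) assms(2), of 0]
    average_cone_integral_nonneg[OF assms(1)] by simp

section \<open>Exponential loss of memory\<close>

lemma iterate_Suc:
  assumes "(f, H) \<in> sys" "integrable M \<phi>"
  shows "AE x in M. transfer_op M f H (Suc n * T) \<phi> x =
    transfer_op M (\<lambda>i. f (n * T + i)) (\<lambda>i. H (n * T + i)) T (transfer_op M f H (n * T) \<phi>) x"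
  using transfer_op_add[OF sys_open[OF assms(1)] assms(2), of "n * T" T] by (simp add: add.commute)

text \<open>Each block returns to the cone and retains at least the fraction
  \<open>z\<^sub>1 / 2\<close> of the mass, so the mass stays positive although it may tend to
  0.\<close>

lemma iterate_in_cone:
  assumes fH: "(f, H) \<in> sys" and \<phi>: "\<phi> \<in> average_cone" "0 < (LINT x|M. \<phi> x)"
  shows "transfer_op M f H (n * T) \<phi> \<in> average_cone"
    and "0 < (LINT x|M. transfer_op M f H (n * T) \<phi> x)"
proof -
  note os = sys_open[OF fH] and int = average_coneD(1)[OF \<phi>(1)]
  note L = transfer_op_integrable[OF os int]
  have "transfer_op M f H (n * T) \<phi> \<in> average_cone \<and>
    0 < (LINT x|M. transfer_op M f H (n * T) \<phi> x)"
  proof (induction n)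
    case 0
    have eq: "AE x in M. \<phi> x = transfer_op M f H 0 \<phi> x"
      using transfer_op_0[OF os int] by eventually_elim simp
    have "(LINT x|M. \<phi> x) = (LINT x|M. transfer_op M f H 0 \<phi> x)"
      by (rule integral_cong_AE) (use int L eq in auto)
    then show ?case
      using \<phi> average_cone_cong_AE[OF \<phi>(1) L eq] by simp
  next
    case (Suc n)
    define u where "u = transfer_op M f H (n * T) \<phi>"
    define v where "v = transfer_op M (\<lambda>i. f (n * T + i)) (\<lambda>i. H (n * T + i)) T u"
    note sh = sys_shift[OF fH, of "n * T"]
    have u: "u \<in> average_cone" "0 < (LINT x|M. u x)" using Suc by (auto simp: u_def)
    have v: "v \<in> average_cone" unfolding v_def by (rule block_in_cone[OF u(1) sh])
    have "0 < z\<^sub>1 / 2 * (LINT x|M. u x)" using u z by simp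
    also have "\<dots> \<le> (LINT x|M. v x)" unfolding v_def by (rule block_integral[OF u(1) sh])
    finally have v0: "0 < (LINT x|M. v x)" .
    have eq: "AE x in M. v x = transfer_op M f H (Suc n * T) \<phi> x"
      using iterate_Suc[OF fH int, of n] unfolding u_def[symmetric] v_def[symmetric]
      by eventually_elim simp
    have "(LINT x|M. v x) = (LINT x|M. transfer_op M f H (Suc n * T) \<phi> x)"
      by (rule integral_cong_AE[OF _ _ eq])
         (rule borel_measurable_integrable[OF average_coneD(1)[OF v]] borel_measurable_integrable[OF L])+
    then show ?case
      using v0 average_cone_cong_AE[OF v L eq] by simp
  qed
  then show "transfer_op M f H (n * T) \<phi> \<in> average_cone"
    "0 < (LINT x|M. transfer_op M f H (n * T) \<phi> x)" by auto
qed

text \<open>One statement for both sides of the squeeze: \<open>b = 1\<close>,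
  \<open>c = - \<alpha>\<close> raises the lower coefficient by \<open>rate * \<kappa>\<close>, and
  \<open>b = - 1\<close>, \<open>c = \<beta>\<close> lowers the upper one by the same
  amount.\<close>

lemma block_difference_iterate:
  assumes fH: "(f, H) \<in> sys" and \<phi>: "\<phi> \<in> average_cone" and \<psi>: "\<psi> \<in> average_cone"
    and y: "y = transfer_op M f H (n * T) \<psi>" "y \<in> average_cone"
    and x: "x \<in> average_cone" "x = (\<lambda>t. b * transfer_op M f H (n * T) \<phi> t + c * y t)"
    and \<kappa>: "0 \<le> \<kappa>" "\<kappa> * (LINT t|M. y t) \<le> (LINT t|M. x t)"
  shows "(\<lambda>t. b * transfer_op M f H (Suc n * T) \<phi> t
    + (c - rate * \<kappa>) * transfer_op M f H (Suc n * T) \<psi> t) \<in> average_cone"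
proof (rule average_cone_cong_AE)
  note os = sys_open[OF fH]
  note int = average_coneD(1)[OF \<phi>] average_coneD(1)[OF \<psi>]
  note sh = sys_shift[OF fH, of "n * T"]
  let ?L = "transfer_op M (\<lambda>i. f (n * T + i)) (\<lambda>i. H (n * T + i)) T"
  note L = transfer_op_integrable[OF os int(1), of "n * T"] transfer_op_integrable[OF os int(2), of "n * T"]
  show "(\<lambda>t. ?L x t - rate * \<kappa> * ?L y t) \<in> average_cone"
    by (rule block_difference_in_cone[OF x(1) y(2) sh \<kappa>])
  show "integrable M (\<lambda>t. b * transfer_op M f H (Suc n * T) \<phi> t
    + (c - rate * \<kappa>) * transfer_op M f H (Suc n * T) \<psi> t)"
    using transfer_op_integrable[OF os int(1), of "Suc n * T"]
      transfer_op_integrable[OF os int(2), of "Suc n * T"]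
    by (intro Bochner_Integration.integrable_add integrable_mult_right)
  show "AE t in M. ?L x t - rate * \<kappa> * ?L y t = b * transfer_op M f H (Suc n * T) \<phi> t
    + (c - rate * \<kappa>) * transfer_op M f H (Suc n * T) \<psi> t"
    using iterate_Suc[OF fH int(1), of n] iterate_Suc[OF fH int(2), of n]
      transfer_op_linear[OF sys_open[OF sh] L, of T b c]
    unfolding x(2) y(1) by eventually_elim (simp add: algebra_simps)
qed

text \<open>The count starts after one block, hence \<open>Suc n\<close>: only block images are
  known to dominate multiples of each other. The bound \<open>rate \<le> \<alpha>\<close> is carried
  along because it later bounds the mass of the first iterate from below by that of the
  second.\<close>

lemma iterates_squeezed:
  assumes fH: "(f, H) \<in> sys" and \<phi>: "\<phi> \<in> average_cone" and \<psi>: "\<psi> \<in> average_cone"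
    and norm: "(LINT x|M. \<phi> x) = 1" "(LINT x|M. \<psi> x) = 1"
  shows "\<exists>\<alpha> \<beta>. rate \<le> \<alpha> \<and> \<alpha> \<le> \<beta> \<and> \<beta> - \<alpha> \<le> 1 / rate * (1 - rate / 2) ^ n \<and>
    (\<lambda>x. transfer_op M f H (Suc n * T) \<phi> x - \<alpha> * transfer_op M f H (Suc n * T) \<psi> x) \<in> average_cone \<and>
    (\<lambda>x. \<beta> * transfer_op M f H (Suc n * T) \<psi> x - transfer_op M f H (Suc n * T) \<phi> x) \<in> average_cone"
proof (induction n)
  case 0
  note os = sys_open[OF fH]
  \<comment> \<open>Equal initial masses permit \<open>\<kappa> = 1\<close> in both orders. This
    yields the starting coefficients \<open>rate\<close> and \<open>1 / rate\<close>.\<close>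
  have *: "(\<lambda>t. transfer_op M f H T p t - rate * transfer_op M f H T q t) \<in> average_cone"
    if "p \<in> average_cone" "q \<in> average_cone" "(LINT x|M. p x) = 1" "(LINT x|M. q x) = 1" for p q
    using block_difference_in_cone[OF that(1,2) fH, of 1] that by simp
  have "(\<lambda>t. 1 / rate * (transfer_op M f H T \<psi> t - rate * transfer_op M f H T \<phi> t)) \<in> average_cone"
    by (rule average_cone_cmult[OF *[OF \<psi> \<phi> norm(2,1)]]) (use rate in simp)
  also have "(\<lambda>t. 1 / rate * (transfer_op M f H T \<psi> t - rate * transfer_op M f H T \<phi> t))
     = (\<lambda>t. 1 / rate * transfer_op M f H T \<psi> t - transfer_op M f H T \<phi> t)"
    using rate by (auto simp: field_simps)
  finally have 2: "(\<lambda>t. 1 / rate * transfer_op M f H T \<psi> t - transfer_op M f H T \<phi> t) \<in> average_cone" .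
  have "rate * rate \<le> 1 * 1" using rate by (intro mult_mono) auto
  then have "rate \<le> 1 / rate" using rate by (simp add: field_simps)
  then show ?case
    using 2 *[OF \<phi> \<psi> norm] rate by (intro exI[of _ rate] exI[of _ "1 / rate"]) auto
next
  case (Suc n)
  let ?u = "transfer_op M f H (Suc n * T) \<phi>" and ?v = "transfer_op M f H (Suc n * T) \<psi>"
  let ?u' = "transfer_op M f H (Suc (Suc n) * T) \<phi>"
    and ?v' = "transfer_op M f H (Suc (Suc n) * T) \<psi>"
  obtain \<alpha> \<beta> where \<alpha>: "rate \<le> \<alpha>" "\<alpha> \<le> \<beta>" and gap: "\<beta> - \<alpha> \<le> 1 / rate * (1 - rate / 2) ^ n"
    and lo: "(\<lambda>x. ?u x - \<alpha> * ?v x) \<in> average_cone"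
    and hi: "(\<lambda>x. \<beta> * ?v x - ?u x) \<in> average_cone"
    using Suc by blast
  have v: "?v \<in> average_cone" by (rule iterate_in_cone[OF fH \<psi>]) (simp add: norm)
  have u: "?u \<in> average_cone" by (rule iterate_in_cone[OF fH \<phi>]) (simp add: norm)
  have ints: "integrable M ?u" "integrable M ?v" using u v average_coneD(1) by auto
  define \<kappa> where "\<kappa> = (\<beta> - \<alpha>) / 2"
  have \<beta>: "\<beta> = \<alpha> + 2 * \<kappa>" by (simp add: \<kappa>_def field_simps)
  have \<kappa>0: "0 \<le> \<kappa>" using \<alpha> by (simp add: \<kappa>_def)
  \<comment> \<open>With \<open>k = 0\<close> the old coefficient is carried over to the next block;
    with \<open>k = \<kappa>\<close> it improves.\<close>
  have lo_step: "(\<lambda>x. ?u' x - (\<alpha> + rate * k) * ?v' x) \<in> average_cone"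
    if "0 \<le> k" "k * (LINT x|M. ?v x) \<le> (LINT x|M. ?u x - \<alpha> * ?v x)" for k
    using block_difference_iterate[OF fH \<phi> \<psi> refl v lo, of 1 "- \<alpha>" k] that
    by (simp add: algebra_simps)
  have hi_step: "(\<lambda>x. (\<beta> - rate * k) * ?v' x - ?u' x) \<in> average_cone"
    if "0 \<le> k" "k * (LINT x|M. ?v x) \<le> (LINT x|M. \<beta> * ?v x - ?u x)" for k
    using block_difference_iterate[OF fH \<phi> \<psi> refl v hi, of "- 1" \<beta> k] that
    by (simp add: algebra_simps)
  have nn: "0 \<le> (LINT x|M. ?u x - \<alpha> * ?v x)" "0 \<le> (LINT x|M. \<beta> * ?v x - ?u x)"
    using average_cone_integral_nonneg lo hi by auto
  \<comment> \<open>The iterate of \<open>\<phi>\<close> cancels in the sum, so at least one of the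
    two masses reaches \<open>\<kappa>\<close> times the mass of \<open>?v\<close>. Only that side
    is improved in this step.\<close>
  have sum: "(LINT x|M. ?u x - \<alpha> * ?v x) + (LINT x|M. \<beta> * ?v x - ?u x) = 2 * (\<kappa> * (LINT x|M. ?v x))"
    using ints by (simp add: \<kappa>_def algebra_simps diff_divide_distrib)
  have r: "rate * \<kappa> \<le> \<kappa>" using rate \<kappa>0 by (intro mult_left_le_one_le) auto
  have r0: "0 \<le> rate * \<kappa>" using rate \<kappa>0 by simp
  have "\<beta> - \<alpha> - rate * \<kappa> = (1 - rate / 2) * (\<beta> - \<alpha>)" by (simp add: \<kappa>_def algebra_simps)
  also have "\<dots> \<le> (1 - rate / 2) * (1 / rate * (1 - rate / 2) ^ n)"
    using gap rate by (intro mult_left_mono) auto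
  finally have gap': "\<beta> - \<alpha> - rate * \<kappa> \<le> 1 / rate * (1 - rate / 2) ^ Suc n" by simp
  consider "\<kappa> * (LINT x|M. ?v x) \<le> (LINT x|M. ?u x - \<alpha> * ?v x)"
    | "\<kappa> * (LINT x|M. ?v x) \<le> (LINT x|M. \<beta> * ?v x - ?u x)"
    using sum by linarith
  then show ?case
  proof cases
    case 1
    have "rate \<le> \<alpha> + rate * \<kappa>" using \<alpha> r0 by linarith
    moreover have "\<alpha> + rate * \<kappa> \<le> \<beta>" using r \<beta> \<kappa>0 by linarith
    moreover have "\<beta> - (\<alpha> + rate * \<kappa>) \<le> 1 / rate * (1 - rate / 2) ^ Suc n" using gap' by linarith
    ultimately show ?thesis
      using lo_step[OF \<kappa>0 1] hi_step[of 0] nn by (intro exI[of _ "\<alpha> + rate * \<kappa>"] exI[of _ \<beta>]) auto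
  next
    case 2
    have "\<alpha> \<le> \<beta> - rate * \<kappa>" using r \<beta> \<kappa>0 by linarith
    moreover have "\<beta> - rate * \<kappa> - \<alpha> \<le> 1 / rate * (1 - rate / 2) ^ Suc n" using gap' by linarith
    ultimately show ?thesis
      using hi_step[OF \<kappa>0 2] lo_step[of 0] nn \<alpha>
      by (intro exI[of _ \<alpha>] exI[of _ "\<beta> - rate * \<kappa>"]) auto
  qed
qed

text \<open>A time inside a block is compared with the end of that block. Norms do not grow, so the
  norm at \<open>m\<close> dominates the norm at the block end, hence the mass there, and this is at
  least \<open>z\<^sub>1 / 2\<close> times the mass at the block start.\<close>

lemma transfer_op_L1norm_pos:
  assumes fH: "(f, H) \<in> sys" and \<phi>: "\<phi> \<in> average_cone" "AE x in M. 0 \<le> \<phi> x"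
    and pos: "0 < (LINT x|M. \<phi> x)"
  shows "0 < L1norm M (transfer_op M f H m \<phi>)"
    and "z\<^sub>1 / 2 * (LINT x|M. transfer_op M f H (m div T * T) \<phi> x) \<le> L1norm M (transfer_op M f H m \<phi>)"
proof -
  define n r where "n = m div T" "r = m mod T"
  note os = sys_open[OF fH] and int = average_coneD(1)[OF \<phi>(1)]
  have "r < T" "n * T + r = m"
    using T_pos by (auto simp: n_r_def)
  then have m: "m + (T - r) = Suc n * T" by simp
  let ?u = "transfer_op M f H (n * T) \<phi>"
  note u = iterate_in_cone[OF fH \<phi>(1) pos, of n]
  note L = transfer_op_integrable[OF os int]
  have "0 < z\<^sub>1 / 2 * (LINT x|M. ?u x)" using u z by simp
  have "z\<^sub>1 / 2 * (LINT x|M. ?u x)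
      \<le> (LINT x|M. transfer_op M (\<lambda>i. f (n * T + i)) (\<lambda>i. H (n * T + i)) T ?u x)"
    by (rule block_integral[OF u(1) sys_shift[OF fH]])
  also have "\<dots> = (LINT x|M. transfer_op M f H (Suc n * T) \<phi> x)"
    by (rule integral_cong_AE)
       (use iterate_Suc[OF fH int, of n] L transfer_op_integrable[OF sys_open[OF sys_shift[OF fH]] L]
         in \<open>auto simp del: mult_Suc intro: borel_measurable_integrable\<close>)
  also have "\<dots> \<le> L1norm M (transfer_op M f H (Suc n * T) \<phi>)"
    using abs_integral_le_L1norm[of M "transfer_op M f H (Suc n * T) \<phi>"] by linarith
  also have "\<dots> = L1norm M (transfer_op M (\<lambda>i. f (m + i)) (\<lambda>i. H (m + i)) (T - r)
      (transfer_op M f H m \<phi>))"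
    unfolding m[symmetric]
    by (rule L1norm_cong_AE[OF L transfer_op_integrable[OF open_system_shift[OF os] L]
          transfer_op_add[OF os int]])
  also have "\<dots> \<le> L1norm M (transfer_op M f H m \<phi>)"
    by (rule transfer_op_L1norm_le[OF open_system_shift[OF os] L])
  finally show *: "z\<^sub>1 / 2 * (LINT x|M. transfer_op M f H (m div T * T) \<phi> x)
      \<le> L1norm M (transfer_op M f H m \<phi>)" by (simp add: n_r_def)
  have "0 < z\<^sub>1 / 2 * (LINT x|M. ?u x)" using u z by simp
  with * show "0 < L1norm M (transfer_op M f H m \<phi>)" by (simp add: n_r_def)
qed

text \<open>With the squeeze at the last complete block, the unfinished block does not increase the
  norm of \<open>?u - \<alpha> * ?v\<close>, which the cone bounds by twice its mass, hence by
  \<open>2 * (\<beta> - \<alpha>) * V\<close>. On the other side, \<open>L1norm M p\<close> is at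
  least \<open>z\<^sub>1 / 2 * rate * V\<close>. The possibly tiny mass \<open>V\<close> cancels;
  normalization adds a factor 2 and the initial gap a factor \<open>1 / rate\<close>.\<close>

theorem normalized_op_contraction:
  assumes fH: "(f, H) \<in> sys"
    and \<phi>: "\<phi> \<in> average_cone" "AE x in M. 0 \<le> \<phi> x" "(LINT x|M. \<phi> x) = 1"
    and \<psi>: "\<psi> \<in> average_cone" "AE x in M. 0 \<le> \<psi> x" "(LINT x|M. \<psi> x) = 1"
  shows "L1norm M (\<lambda>x. normalized_op M f H m \<phi> x - normalized_op M f H m \<psi> x)
    \<le> 8 / (z\<^sub>1 * rate\<^sup>2) * (1 - rate / 2) ^ (m div T - 1)"
proof -
  note os = sys_open[OF fH]
  note int = average_coneD(1)[OF \<phi>(1)] average_coneD(1)[OF \<psi>(1)]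
  define p q where "p = transfer_op M f H m \<phi>" "q = transfer_op M f H m \<psi>"
  have L: "integrable M p" "integrable M q"
    unfolding p_q_def using transfer_op_integrable[OF os] int by auto
  have eqs: "L1norm M p = (LINT x|M. p x)" "L1norm M q = (LINT x|M. q x)"
    unfolding p_q_def
    using transfer_op_nonneg[OF os int(1) \<phi>(2)] transfer_op_nonneg[OF os int(2) \<psi>(2)] L
    by (auto intro!: L1norm_eq_integral simp: p_q_def)
  have pos: "0 < L1norm M p" "0 < L1norm M q"
    unfolding p_q_def using transfer_op_L1norm_pos(1)[OF fH] \<phi> \<psi> by auto
  have bound: "L1norm M (\<lambda>x. normalized_op M f H m \<phi> x - normalized_op M f H m \<psi> x)
      \<le> 2 * L1norm M (\<lambda>x. p x - r * q x) / L1norm M p" for r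
    using L1norm_normalized_diff_le[OF L(1,2) eqs(1) pos(1) eqs(2) pos(2), of r]
    by (simp add: normalized_op_def p_q_def)
  show ?thesis
  proof (cases "m div T")
    case 0
    \<comment> \<open>No block is complete and the truncated exponent is 0. The trivial bound 2,
      obtained with \<open>r = 0\<close>, suffices because the constant is at least 8.\<close>
    have "z\<^sub>1 * rate\<^sup>2 \<le> 1 * 1"
      using z rate by (intro mult_mono power_le_one) auto
    then have "2 \<le> 8 / (z\<^sub>1 * rate\<^sup>2)" using z rate by (simp add: field_simps)
    moreover have "2 * L1norm M (\<lambda>x. p x - 0 * q x) / L1norm M p = 2" using pos by simp
    ultimately show ?thesis using bound[of 0] 0 by simp
  next
    case (Suc n)
    let ?u = "transfer_op M f H (Suc n * T) \<phi>" and ?v = "transfer_op M f H (Suc n * T) \<psi>"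
    obtain \<alpha> \<beta> where \<alpha>: "rate \<le> \<alpha>" "\<alpha> \<le> \<beta>" and gap: "\<beta> - \<alpha> \<le> 1 / rate * (1 - rate / 2) ^ n"
      and lo: "(\<lambda>x. ?u x - \<alpha> * ?v x) \<in> average_cone"
      and hi: "(\<lambda>x. \<beta> * ?v x - ?u x) \<in> average_cone"
      using iterates_squeezed[OF fH \<phi>(1) \<psi>(1) \<phi>(3) \<psi>(3), of n] by blast
    have iu: "integrable M ?u" "integrable M ?v" using transfer_op_integrable[OF os] int by auto
    define V where "V = (LINT x|M. ?v x)"
    have V0: "0 < V" unfolding V_def by (rule iterate_in_cone[OF fH \<psi>(1)]) (simp add: \<psi>(3))
    have lower: "\<alpha> * V \<le> (LINT x|M. ?u x)" and upper: "(LINT x|M. ?u x) \<le> \<beta> * V"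
      using average_cone_integral_nonneg[OF lo] average_cone_integral_nonneg[OF hi] iu
      by (auto simp: V_def)
    let ?f = "\<lambda>i. f (Suc n * T + i)" and ?H = "\<lambda>i. H (Suc n * T + i)"
    have msplit: "Suc n * T + m mod T = m"
      using div_mult_mod_eq[of m T] Suc by simp
    have osh: "open_system M ?f ?H" by (rule open_system_shift[OF os])
    define w where "w = (\<lambda>x. ?u x - \<alpha> * ?v x)"
    have w: "integrable M w" using iu by (simp add: w_def)
    have "AE x in M. p x = transfer_op M ?f ?H (m mod T) ?u x"
      using transfer_op_add[OF os int(1), of "Suc n * T" "m mod T"] unfolding msplit p_q_def .
    moreover have "AE x in M. q x = transfer_op M ?f ?H (m mod T) ?v x"
      using transfer_op_add[OF os int(2), of "Suc n * T" "m mod T"] unfolding msplit p_q_def .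
    moreover have "AE x in M. transfer_op M ?f ?H (m mod T) w x
        = transfer_op M ?f ?H (m mod T) ?u x - \<alpha> * transfer_op M ?f ?H (m mod T) ?v x"
      using transfer_op_linear[OF osh iu, of "m mod T" 1 "- \<alpha>"] by (simp add: w_def)
    ultimately have "AE x in M. p x - \<alpha> * q x = transfer_op M ?f ?H (m mod T) w x"
      by eventually_elim simp
    then have "L1norm M (\<lambda>x. p x - \<alpha> * q x) = L1norm M (transfer_op M ?f ?H (m mod T) w)"
      using L transfer_op_integrable[OF osh w] by (intro L1norm_cong_AE) auto
    also have "\<dots> \<le> L1norm M w" by (rule transfer_op_L1norm_le[OF osh w])
    also have "\<dots> \<le> 2 * (LINT x|M. w x)"
      unfolding w_def by (rule average_cone_L1norm_le[OF lo])
    also have "(LINT x|M. w x) = (LINT x|M. ?u x) - \<alpha> * V"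
      using iu by (simp add: w_def V_def)
    also have "\<dots> \<le> (\<beta> - \<alpha>) * V" using upper by (simp add: algebra_simps)
    finally have num: "L1norm M (\<lambda>x. p x - \<alpha> * q x) \<le> 2 * ((\<beta> - \<alpha>) * V)" by simp
    have "rate * V \<le> (LINT x|M. ?u x)"
      using lower mult_right_mono[OF \<alpha>(1), of V] V0 by linarith
    then have "z\<^sub>1 / 2 * (rate * V) \<le> z\<^sub>1 / 2 * (LINT x|M. ?u x)"
      using z by (intro mult_left_mono) auto
    also have "\<dots> \<le> L1norm M p"
      using transfer_op_L1norm_pos(2)[OF fH \<phi>(1,2), of m] \<phi>(3) unfolding Suc p_q_def by simp
    finally have den: "z\<^sub>1 / 2 * (rate * V) \<le> L1norm M p" .
    have "2 * L1norm M (\<lambda>x. p x - \<alpha> * q x) / L1norm M p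
        \<le> 2 * (2 * ((\<beta> - \<alpha>) * V)) / (z\<^sub>1 / 2 * (rate * V))"
    proof (rule frac_le)
      show "0 \<le> 2 * (2 * ((\<beta> - \<alpha>) * V))" using \<alpha> V0 by simp
      show "2 * L1norm M (\<lambda>x. p x - \<alpha> * q x) \<le> 2 * (2 * ((\<beta> - \<alpha>) * V))" using num by linarith
      show "0 < z\<^sub>1 / 2 * (rate * V)" using z rate V0 by simp
    qed (rule den)
    also have "\<dots> = 8 / (z\<^sub>1 * rate) * (\<beta> - \<alpha>)"
      using V0 z rate by (simp add: field_simps)
    also have "\<dots> \<le> 8 / (z\<^sub>1 * rate) * (1 / rate * (1 - rate / 2) ^ n)"
      using gap z rate by (intro mult_left_mono) auto
    also have "\<dots> = 8 / (z\<^sub>1 * rate\<^sup>2) * (1 - rate / 2) ^ n" by (simp add: power2_eq_square)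
    finally show ?thesis using bound[of \<alpha>] Suc by simp
  qed
qed

end

section \<open>Choice of the constants\<close>

lemma mixing_partition_measure_pos:
  assumes "mixing_partitions vol \<zeta>\<^sub>1 \<zeta>\<^sub>2 g \<Q> E" "0 < \<zeta>\<^sub>1" "1 \<le> n" "J \<in> \<Q> n"
  shows "0 < measure vol J"
proof (rule ccontr)
  assume "\<not> 0 < measure vol J"
  then have "measure vol J = 0" using measure_nonneg[of vol J] by linarith
  \<comment> \<open>For a null atom the quotient has denominator 0, hence value 0, and cannot exceed
    the positive \<open>\<zeta>\<^sub>1\<close>.\<close>
  moreover have "\<zeta>\<^sub>1 < measure vol (J \<inter> (g ^^ E n) -` J) / (measure vol J * measure vol J)"
    using assms unfolding mixing_partitions_def by blast
  ultimately show False using assms(2) by simp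
qed

lemma mixing_partitions_small:
  assumes "mixing_partitions vol \<zeta>\<^sub>1 \<zeta>\<^sub>2 g \<Q> E" "0 < \<eta>"
  shows "\<exists>n\<ge>1. \<forall>J\<in>\<Q> n. measure vol J \<le> \<eta>"
proof -
  have "(\<lambda>n. SUP A\<in>\<Q> n. measure vol A) \<longlonglongrightarrow> 0"
    using assms(1) by (simp add: mixing_partitions_def)
  then have "\<forall>\<^sub>F n in sequentially. (SUP A\<in>\<Q> n. measure vol A) < \<eta>"
    using assms(2) by (rule order_tendstoD)
  then have "\<forall>\<^sub>F n in sequentially. (SUP A\<in>\<Q> n. measure vol A) < \<eta> \<and> 1 \<le> n"
    by (rule eventually_conj[OF _ eventually_ge_at_top])
  then obtain n where n: "(SUP A\<in>\<Q> n. measure vol A) < \<eta>" "1 \<le> n"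
    using eventually_happens[of _ sequentially] by auto
  have "finite (\<Q> n)" using assms(1) n(2) by (simp add: mixing_partitions_def)
  then have "measure vol J \<le> \<eta>" if "J \<in> \<Q> n" for J
    using cSUP_upper[OF that, of "measure vol"] n(1) by (simp add: bdd_above_finite)
  then show ?thesis using n(2) by blast
qed

text \<open>Atoms have positive measure, so the conditional expectation at any point of an atom is
  the average over it, and one point per atom suffices. These averages are nonnegative, so nothing
  is truncated in the passage to \<open>ennreal\<close>.\<close>

lemma (in mixing_block) density_cone_in_average_cone:
  assumes "\<phi> \<in> densities M s \<inter> density_cone M s a \<Q>"
  shows "\<phi> \<in> average_cone" "AE x in M. 0 \<le> \<phi> x" "(LINT x|M. \<phi> x) = 1"
proof -
  have int: "integrable M \<phi>" and fin: "s UNIV \<phi> < \<infinity>" and nn: "AE x in M. 0 \<le> \<phi> x"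
    and norm: "L1norm M \<phi> = 1"
    and cone: "\<And>x. s UNIV \<phi> \<le> ennreal (a * real_cond_exp M (sigma UNIV \<Q>) \<phi> x)"
    using assms by (auto simp: densities_def density_cone_def)
  show "AE x in M. 0 \<le> \<phi> x" by (rule nn)
  show "(LINT x|M. \<phi> x) = 1" using L1norm_eq_integral[OF int nn] norm by simp
  have "enn2real (s UNIV \<phi>) * measure M J \<le> a * (LINT x:J|M. \<phi> x)" if J: "J \<in> \<Q>" for J
  proof -
    have "J \<noteq> {}" using \<Q>(2) J by (auto simp: partition_on_def)
    then obtain x where x: "x \<in> J" by auto
    have I0: "0 \<le> (LINT x:J|M. \<phi> x)"
      unfolding set_lebesgue_integral_def by (rule integral_nonneg_AE) (use nn in auto)
    have "s UNIV \<phi> \<le> ennreal (a * (1 / measure M J * (LINT x:J|M. \<phi> x)))"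
      using cone[of x] unfolding real_cond_exp_partition[OF prob_space_axioms UNIV_sets(2) \<Q> int J
          measure_pos[OF J] x] .
    from enn2real_mono[OF this] have "enn2real (s UNIV \<phi>) \<le> a * (1 / measure M J * (LINT x:J|M. \<phi> x))"
      using a_pos I0 by simp
    then show ?thesis using measure_pos[OF J] by (simp add: field_simps)
  qed
  then show "\<phi> \<in> average_cone" using int fin by (simp add: average_cone_def)
qed

theorem mainTheorem1:
  fixes \<A> :: "('a::{t2_space, second_countable_topology}, 'n::finite) chart set"
    and G :: "('a, 'n) chart \<Rightarrow> real^'n \<Rightarrow> real^'n^'n"
    and vol :: "'a measure"
    and \<M> :: "('a \<Rightarrow> 'a) set"
    and d :: "('a \<Rightarrow> 'a) \<Rightarrow> ('a \<Rightarrow> 'a) \<Rightarrow> real"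
    and \<H> :: "'a set set"
    and s :: "'a set \<Rightarrow> ('a \<Rightarrow> real) \<Rightarrow> ennreal"
    and \<zeta>\<^sub>1 \<zeta>\<^sub>2 :: real
    and g :: "'a \<Rightarrow> 'a"
    and \<Q> :: "nat \<Rightarrow> 'a set set"
    and E :: "nat \<Rightarrow> nat"
  assumes "compact_riemannian_manifold \<A> G"
    and "riemannian_volume \<A> G vol"
    and "emeasure vol UNIV = 1"
    and "Metric_space \<M> d"
    and "\<forall>f\<in>\<M>. nonsingular vol f"
    and "\<H> \<subseteq> sets borel"
    and "localized_seminorm vol s"
    and "lasota_yorke vol \<M> d \<H> s"
    and "seminorm_strength vol s"
    and "0 < \<zeta>\<^sub>1" and "\<zeta>\<^sub>1 < 1" and "1 < \<zeta>\<^sub>2"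
    and "g \<in> \<M> \<inter> mixing_class vol \<zeta>\<^sub>1 \<zeta>\<^sub>2"
    and "mixing_partitions vol \<zeta>\<^sub>1 \<zeta>\<^sub>2 g \<Q> E"
    and "stably_mixing vol \<M> d \<H> \<zeta>\<^sub>1 \<zeta>\<^sub>2 g \<Q> E"
  shows "\<exists>a>0. \<exists>n\<^sub>0\<ge>1. \<exists>\<delta>\<^sub>0>0. \<exists>\<epsilon>\<^sub>0>0. \<exists>\<Lambda>\<in>{0<..<1}. \<exists>C\<^sub>0>0.
    \<forall>f H. (\<forall>i\<ge>1. f i \<in> Metric_space.mball \<M> d g \<delta>\<^sub>0) \<longrightarrow>
      (\<forall>j\<ge>1. H j \<in> \<H> \<and> measure vol (H j) \<le> \<epsilon>\<^sub>0) \<longrightarrow>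
      (\<forall>\<phi>\<in>densities vol s \<inter> density_cone vol s a (\<Q> n\<^sub>0).
       \<forall>\<psi>\<in>densities vol s \<inter> density_cone vol s a (\<Q> n\<^sub>0). \<forall>m.
         L1norm vol (transfer_op vol f H m \<phi>) \<noteq> 0 \<and>
         L1norm vol (transfer_op vol f H m \<psi>) \<noteq> 0 \<and>
         L1norm vol (\<lambda>x. normalized_op vol f H m \<phi> x - normalized_op vol f H m \<psi> x)
           \<le> C\<^sub>0 * \<Lambda> ^ m)"
proof -
  interpret MS: Metric_space \<M> d by fact
  have sets_vol: "sets vol = sets borel" using assms(2) by (simp add: riemannian_volume_def)
  then have space_vol: "space vol = UNIV" using sets_eq_imp_space_eq by fastforce
  interpret vol: prob_space vol
    by (rule prob_spaceI) (simp add: space_vol assms(3))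
  have g: "g \<in> \<M>" using assms(13) by simp
  note mix = assms(14)
  from bspec[OF assms(8)[unfolded lasota_yorke_def] g]
  obtain N T\<^sub>1 \<theta> C where N: "openin MS.mtopology N" "g \<in> N" and T1: "T\<^sub>1 \<ge> (1::nat)"
    and \<theta>: "0 < \<theta>" "\<theta> < 1" and C: "0 < C"
    and ly: "\<forall>f H. (\<forall>i\<ge>1. f i \<in> N) \<longrightarrow> (\<forall>j\<ge>1. H j \<in> \<H>) \<longrightarrow>
      (\<forall>\<phi> k. integrable vol \<phi> \<longrightarrow>
        s UNIV (transfer_op vol f H (k * T\<^sub>1) \<phi>)
          \<le> ennreal (\<theta> ^ (k * T\<^sub>1)) * s UNIV \<phi> + ennreal (C * L1norm vol \<phi>))"
    by (elim exE conjE) (rule that)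
  obtain \<delta>' where \<delta>': "0 < \<delta>'" "MS.mball g \<delta>' \<subseteq> N"
    using N unfolding MS.openin_mtopology by blast
  from assms(9)[unfolded seminorm_strength_def]
  obtain M\<^sub>1 M\<^sub>2 where M: "0 < M\<^sub>1" "0 < M\<^sub>2"
    and strength1: "\<forall>P \<phi>. finite P \<longrightarrow> partition_on UNIV P \<longrightarrow> P \<subseteq> sets vol \<longrightarrow> integrable vol \<phi> \<longrightarrow>
           s UNIV \<phi> < \<infinity> \<longrightarrow> ennreal M\<^sub>1 * (\<Sum>A\<in>P. s A \<phi>) \<le> s UNIV \<phi>"
    and strength2: "\<forall>A \<phi>. A \<in> sets vol \<longrightarrow> measure vol A > 0 \<longrightarrow> integrable vol \<phi> \<longrightarrow> s UNIV \<phi> < \<infinity> \<longrightarrow>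
           (AE z in vol. z \<in> A \<longrightarrow>
              ennreal (M\<^sub>2 * \<bar>1 / measure vol A * (LINT x:A|vol. \<phi> x) - \<phi> z\<bar>) \<le> s A \<phi>)"
    by (elim exE conjE) (rule that)
  \<comment> \<open>Makes \<open>16 * C \<le> a * \<zeta>\<^sub>1\<close> an equality; it involves
    no partition, so the partition may depend on it.\<close>
  define a where "a = 16 * C / \<zeta>\<^sub>1"
  have a: "0 < a" using C assms(10) by (simp add: a_def)
  \<comment> \<open>Makes \<open>D_small\<close> an equality; the mixing partition is then taken
    with atoms of measure at most \<open>D\<close>.\<close>
  define D where "D = \<zeta>\<^sub>1 * (M\<^sub>1 * M\<^sub>2) / (2 * \<zeta>\<^sub>2 * a)"
  have "0 < D" using M a assms(10,12) by (simp add: D_def)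
  then obtain n\<^sub>0 where n0: "1 \<le> n\<^sub>0" and small: "\<And>J. J \<in> \<Q> n\<^sub>0 \<Longrightarrow> measure vol J \<le> D"
    using mixing_partitions_small[OF mix] by blast
  have Q: "finite (\<Q> n\<^sub>0)" "partition_on UNIV (\<Q> n\<^sub>0)" "\<Q> n\<^sub>0 \<subseteq> sets vol"
    using mix n0 by (auto simp: mixing_partitions_def)
  have Qpos: "0 < measure vol J" if "J \<in> \<Q> n\<^sub>0" for J
    by (rule mixing_partition_measure_pos[OF mix assms(10) n0 that])
  have "(\<lambda>n. \<theta> ^ n) \<longlonglongrightarrow> 0" using \<theta> by (intro LIMSEQ_power_zero) simp
  then have "\<forall>\<^sub>F n in sequentially. \<theta> ^ n < \<zeta>\<^sub>1 / 8"
    using assms(10) by (intro order_tendstoD) auto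
  then obtain n\<^sub>1 where n1: "\<And>n. n\<^sub>1 \<le> n \<Longrightarrow> \<theta> ^ n < \<zeta>\<^sub>1 / 8"
    by (auto simp: eventually_sequentially)
  \<comment> \<open>The Lasota--Yorke inequality is available at multiples of
    \<open>T\<^sub>1\<close> only. The block must contract below \<open>\<zeta>\<^sub>1 / 8\<close>,
    outlast the mixing time \<open>E n\<^sub>0\<close>, and have positive length.\<close>
  define k where "k = n\<^sub>1 + E n\<^sub>0 + 1"
  define T where "T = k * T\<^sub>1"
  have "k * 1 \<le> T" unfolding T_def using T1 by (intro mult_left_mono) auto
  then have T: "n\<^sub>1 \<le> T" "E n\<^sub>0 \<le> T" "0 < T" by (auto simp: k_def)
  from assms(15)[unfolded stably_mixing_def, THEN spec, THEN mp, OF n0, THEN spec, THEN mp, OF T(2)]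
  obtain \<delta> \<epsilon> where \<delta>: "0 < \<delta>" and \<epsilon>: "0 < \<epsilon>"
    and stable: "\<forall>f H. (\<forall>k\<in>{1..T}. f k \<in> MS.mball g \<delta>) \<longrightarrow>
        (\<forall>j\<in>{1..T}. H j \<in> \<H> \<and> measure vol (H j) \<le> \<epsilon>) \<longrightarrow> (\<forall>J\<^sub>1\<in>\<Q> n\<^sub>0. \<forall>J\<^sub>2\<in>\<Q> n\<^sub>0.
        \<zeta>\<^sub>1 < measure vol (J\<^sub>1 \<inter> open_preimage f H T J\<^sub>2) / (measure vol J\<^sub>1 * measure vol J\<^sub>2) \<and>
        measure vol (J\<^sub>1 \<inter> open_preimage f H T J\<^sub>2) / (measure vol J\<^sub>1 * measure vol J\<^sub>2) < \<zeta>\<^sub>2)"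
    by (elim exE conjE) (rule that)
  \<comment> \<open>The radius \<open>\<delta>'\<close> keeps all maps in the Lasota--Yorke
    neighbourhood, \<open>\<delta>\<close> gives mixing over blocks of length
    \<open>T\<close>.\<close>
  define \<delta>\<^sub>0 where "\<delta>\<^sub>0 = min \<delta> \<delta>'"
  have \<delta>0: "0 < \<delta>\<^sub>0" using \<delta> \<delta>' by (simp add: \<delta>\<^sub>0_def)
  define sys where "sys = {(f, H). (\<forall>i\<ge>1::nat. f i \<in> MS.mball g \<delta>\<^sub>0) \<and>
    (\<forall>j\<ge>1::nat. H j \<in> \<H> \<and> measure vol (H j) \<le> \<epsilon>)}"
  interpret mixing_block vol s M\<^sub>1 M\<^sub>2 "\<Q> n\<^sub>0" D a \<zeta>\<^sub>1 \<zeta>\<^sub>2 C "\<theta> ^ T" T sys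
  proof unfold_locales
    show "localized_seminorm vol s" by fact
    show "ennreal M\<^sub>1 * (\<Sum>A\<in>\<Q> n\<^sub>0. s A \<phi>) \<le> s UNIV \<phi>"
      if "integrable vol \<phi>" "s UNIV \<phi> < \<infinity>" for \<phi>
      by (rule strength1[THEN spec, THEN spec, THEN mp, THEN mp, THEN mp, THEN mp, THEN mp, OF Q that])
    show "AE z in vol. z \<in> A \<longrightarrow>
        ennreal (M\<^sub>2 * \<bar>1 / measure vol A * (LINT x:A|vol. \<phi> x) - \<phi> z\<bar>) \<le> s A \<phi>"
      if "A \<in> \<Q> n\<^sub>0" "integrable vol \<phi>" "s UNIV \<phi> < \<infinity>" for A \<phi>
      by (rule strength2[THEN spec, THEN spec, THEN mp, THEN mp, THEN mp, THEN mp, OF _ Qpos[OF that(1)] that(2,3)]) (use Q(3) that(1) in blast)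
    show "D * a / (M\<^sub>1 * M\<^sub>2) \<le> \<zeta>\<^sub>1 / (2 * \<zeta>\<^sub>2)"
      using M a by (simp add: D_def)
    show "\<theta> ^ T \<le> \<zeta>\<^sub>1 / 8" using n1[OF T(1)] by simp
    show "16 * C \<le> a * \<zeta>\<^sub>1" using assms(10) by (simp add: a_def)
    show "open_system vol f H" if "(f, H) \<in> sys" for f H
      using that assms(5,6) sets_vol space_vol
      by (auto simp: sys_def open_system_def)
    show "(\<lambda>i. f (m + i), \<lambda>i. H (m + i)) \<in> sys" if "(f, H) \<in> sys" for f H m
      using that unfolding sys_def by (auto simp del: MS.in_mball)
    show "s UNIV (transfer_op vol f H T \<phi>)
        \<le> ennreal (\<theta> ^ T) * s UNIV \<phi> + ennreal (C * L1norm vol \<phi>)"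
      if "(f, H) \<in> sys" "integrable vol \<phi>" for f H \<phi>
      unfolding T_def
    proof (rule ly[THEN spec, THEN spec, THEN mp, THEN mp, THEN spec, THEN spec, THEN mp, OF _ _ that(2)])
      show "\<forall>i\<ge>1. f i \<in> N"
        using that(1) \<delta>'(2) by (auto simp: sys_def \<delta>\<^sub>0_def)
      show "\<forall>j\<ge>1. H j \<in> \<H>" using that(1) by (auto simp: sys_def)
    qed
    show "\<zeta>\<^sub>1 * (measure vol J\<^sub>1 * measure vol J\<^sub>2) \<le> measure vol (J\<^sub>1 \<inter> open_preimage f H T J\<^sub>2) \<and>
        measure vol (J\<^sub>1 \<inter> open_preimage f H T J\<^sub>2) \<le> \<zeta>\<^sub>2 * (measure vol J\<^sub>1 * measure vol J\<^sub>2)"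
      if fH: "(f, H) \<in> sys" and J: "J\<^sub>1 \<in> \<Q> n\<^sub>0" "J\<^sub>2 \<in> \<Q> n\<^sub>0" for f H J\<^sub>1 J\<^sub>2
    proof -
      define b where "b = measure vol J\<^sub>1 * measure vol J\<^sub>2"
      have b: "0 < b" using Qpos J by (simp add: b_def)
      have "\<forall>k\<in>{1..T}. f k \<in> MS.mball g \<delta>"
        using fH by (auto simp: sys_def \<delta>\<^sub>0_def)
      moreover have "\<forall>j\<in>{1..T}. H j \<in> \<H> \<and> measure vol (H j) \<le> \<epsilon>"
        using fH by (auto simp: sys_def)
      ultimately have "\<zeta>\<^sub>1 < measure vol (J\<^sub>1 \<inter> open_preimage f H T J\<^sub>2) / b \<and>
          measure vol (J\<^sub>1 \<inter> open_preimage f H T J\<^sub>2) / b < \<zeta>\<^sub>2"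
        unfolding b_def
        by (rule bspec[OF bspec[OF stable[THEN spec, THEN spec, THEN mp, THEN mp] J(1)] J(2)])
      then show ?thesis using b unfolding b_def[symmetric] by (simp add: field_simps)
    qed
  qed (use M Q Qpos small a assms C \<theta> T in auto)
  define \<gamma> where "\<gamma> = 1 - rate / 2"
  have \<gamma>: "0 < \<gamma>" "\<gamma> < 1" using rate by (auto simp: \<gamma>_def)
  \<comment> \<open>The gain \<open>\<gamma>\<close> per block, spread evenly over its
    \<open>T\<close> steps.\<close>
  define \<Lambda> where "\<Lambda> = root T \<gamma>"
  have \<Lambda>: "0 < \<Lambda>" "\<Lambda> < 1" "\<Lambda> ^ T = \<gamma>"
    using \<gamma> T(3) by (auto simp: \<Lambda>_def)
  define K where "K = 8 / (\<zeta>\<^sub>1 * rate\<^sup>2)"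
  have K: "0 < K" using assms(10) rate by (simp add: K_def)
  have decay: "K * \<gamma> ^ (m div T - 1) \<le> K / \<gamma>\<^sup>2 * \<Lambda> ^ m" for m
  proof -
    \<comment> \<open>The \<open>+ 2\<close> pays for the unfinished block and for the subtraction
      of 1, including the truncated case \<open>m < T\<close>. It costs the factor
      \<open>1 / \<gamma>\<^sup>2\<close> in the constant.\<close>
    have "m mod T < T" using T(3) by simp
    moreover have "T * (m div T) \<le> T * ((m div T - 1) + 1)" by (intro mult_left_mono) auto
    moreover have "T * ((m div T - 1) + 2) = T * ((m div T - 1) + 1) + T"
      by (simp add: distrib_left)
    ultimately have "m \<le> T * ((m div T - 1) + 2)"
      using mult_div_mod_eq[of T m] by linarith
    then have "\<Lambda> ^ (T * ((m div T - 1) + 2)) \<le> \<Lambda> ^ m"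
      using \<Lambda> by (intro power_decreasing) auto
    then have "\<gamma> ^ (m div T - 1) * \<gamma>\<^sup>2 \<le> \<Lambda> ^ m"
      by (simp only: power_mult \<Lambda>(3) power_add)
    then have "\<gamma> ^ (m div T - 1) \<le> \<Lambda> ^ m / \<gamma>\<^sup>2"
      using \<gamma> by (simp add: field_simps)
    then have "K * \<gamma> ^ (m div T - 1) \<le> K * (\<Lambda> ^ m / \<gamma>\<^sup>2)"
      using K by (intro mult_left_mono) auto
    then show ?thesis by simp
  qed
  have main: "L1norm vol (transfer_op vol f H m \<phi>) \<noteq> 0 \<and>
      L1norm vol (transfer_op vol f H m \<psi>) \<noteq> 0 \<and>
      L1norm vol (\<lambda>x. normalized_op vol f H m \<phi> x - normalized_op vol f H m \<psi> x)
        \<le> K / \<gamma>\<^sup>2 * \<Lambda> ^ m"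
    if "\<forall>i\<ge>1. f i \<in> MS.mball g \<delta>\<^sub>0" "\<forall>j\<ge>1. H j \<in> \<H> \<and> measure vol (H j) \<le> \<epsilon>"
      and \<phi>: "\<phi> \<in> densities vol s \<inter> density_cone vol s a (\<Q> n\<^sub>0)"
      and \<psi>: "\<psi> \<in> densities vol s \<inter> density_cone vol s a (\<Q> n\<^sub>0)" for f H \<phi> \<psi> m
  proof -
    have fH: "(f, H) \<in> sys" using that(1,2) unfolding sys_def by blast
    note \<phi>' = density_cone_in_average_cone[OF \<phi>] and \<psi>' = density_cone_in_average_cone[OF \<psi>]
    show ?thesis
      using transfer_op_L1norm_pos(1)[OF fH \<phi>'(1,2), of m] \<phi>'(3)
        transfer_op_L1norm_pos(1)[OF fH \<psi>'(1,2), of m] \<psi>'(3)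
        order_trans[OF normalized_op_contraction[OF fH \<phi>' \<psi>', of m] decay[of m, unfolded K_def \<gamma>_def]]
      unfolding K_def \<gamma>_def by simp
  qed
  have pos: "0 < K / \<gamma>\<^sup>2" using K \<gamma> by simp
  show ?thesis
  proof (rule exI[of _ a], rule conjI[OF a], rule exI[of _ n\<^sub>0], rule conjI[OF n0],
      rule exI[of _ \<delta>\<^sub>0], rule conjI[OF \<delta>0], rule exI[of _ \<epsilon>], rule conjI[OF \<epsilon>],
      rule bexI[of _ \<Lambda>], rule exI[of _ "K / \<gamma>\<^sup>2"], rule conjI[OF pos], intro allI impI ballI)
    show "\<Lambda> \<in> {0<..<1}" using \<Lambda> by simp
  qed (rule main)
qed

end
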